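(* Let $U(u)=\sum_{i=1}^\infty a_iu^{2i}$ be analytic on $\mathbb R$ (the series converging for all $u\in\mathbb R$), with $a_1>0$, $a_i\ge0$ for all $i>1$ and not all of the $a_i$, $i>1$, equal to zero. Let $\hat f$ be an E-flux and let $u(\cdot,t)\in\mathbb V^k$ be a solution of Scheme B with damping coefficient $\tilde B_j[u;U]$. Then $u$ satisfies, for every function $$V(u)=\sum_{i=1}^\infty b_iu^{2i},\qquad b_1\ge a_1,\quad 0\le b_i\le a_i\ \text{ for all } i>1,$$ the local entropy inequality $$\frac{d}{dt}\int_{I_j}V(u)\,dx+\hat{\mathcal F}^V_{j+\frac12}-\hat{\mathcal F}^V_{j-\frac12}\le0,\qquad j=1,\dots,N .$$ Thus, with this $U$, the scheme satisfies infinitely many entropy inequalities.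
   Context: Let $f:\mathbb R\to\mathbb R$ be smooth (conservation law $u_t+f(u)_x=0$ on an interval $I$). $I$ is divided into cells $I_j=[x_{j-\frac12},x_{j+\frac12}]$, $j=1,\dots,N$, $h_j=|I_j|$. Fix $k\ge1$; $\mathbb V^k=\{v\in L^2(I): v|_{I_j}\in\mathbb P^k(I_j)\ \forall j\}$ ($\mathbb P^k$: polynomials of degree $\le k$); $\pi$ is the $L^2$-projection onto $\mathbb V^k$; $v^\pm_{j+\frac12}=v(x^\pm_{j+\frac12})$; $\overline u_j$ is the average of $u$ on $I_j$; exterior traces at the end-points of $I$ are supplied by the boundary conditions. Put $\hat f_{j+\frac12}=\hat f(u^-_{j+\frac12},u^+_{j+\frac12})$, $H^+_{j-\frac12}=\hat f_{j-\frac12}-f(u^+_{j-\frac12})$, $H^-_{j+\frac12}=-\hat f_{j+\frac12}+f(u^-_{j+\frac12})$. E-flux: $\hat f$ is consistent ($\hat f(u,u)=f(u)$), locally Lipschitz continuous, and $(\hat f(u^-,u^+)-f(u))(u^+-u^-)\le0$ for all $u$ between $u^-$ and $u^+$. Constants: $C_k>0$ is the optimal constant with $\|p\|_{L^4(I_j)}\le \sqrt{C_k}\,h_j^{-1/4}\|p\|_{L^2(I_j)}$ for all $p\in\mathbb P^k(I_j)$. $\beta_k$ is a constant depending only on $k$ (for instance $(k+1)^4$ is admissible) such that, for every $W\in C^3(\mathbb R)$, $u\in\mathbb V^k$ and $j$, both $|\pi[W'(u)-W'(u^+_{j-\frac12})](x^+_{j-\frac12})|$ and $|\pi[W'(u)-W'(u^-_{j+\frac12})](x^-_{j+\frac12})|$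 are at most $\frac{\beta_k}{2h_j}\max_{x\in I_j}|W'''(u(x))|\int_{I_j}|u-\overline u_j|^2dx$. Damping coefficient (for $U$ with $\min_{w\in\mathbb R}U''(w)>0$): $$\tilde B_j[u;U]:=\frac{\max_{x\in I_j}|U'''(u(x))|}{\min_{w\in\mathbb R}U''(w)}\Big\{\frac{C_k}{2\sqrt{h_j}}\|f(u)_x-\pi[f(u)_x]\|_{L^2(I_j)}+\frac{\beta_k}{2h_j}\big(|H^+_{j-\frac12}|+|H^-_{j+\frac12}|\big)\Big\}.$$ Scheme B with $\tilde B_j$: seek $u(\cdot,t)\in\mathbb V^k$ such that for all $v\in\mathbb V^k$ and all $j$, $$\int_{I_j}u_tv\,dx-\int_{I_j}f(u)v_x\,dx+\hat f_{j+\frac12}v^-_{j+\frac12}-\hat f_{j-\frac12}v^+_{j-\frac12}=-\tilde B_j[u;U]\int_{I_j}(u-\overline u_j)v\,dx.$$ Numerical entropy flux for $V$: let $\mathcal F_V$ satisfy $\mathcal F_V'=V'f'$, $\psi_V=V'f-\mathcal F_V$, and $\hat{\mathcal F}^V_{j+\frac12}=V'(u^-_{j+\frac12})\hat f_{j+\frac12}-\psi_V(u^-_{j+\frac12})$. *)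

theory Defs
  imports "HOL-Analysis.Analysis" "HOL-Computational_Algebra.Polynomial"
begin

definition smooth :: "(real \<Rightarrow> real) \<Rightarrow> bool" where
  "smooth f \<longleftrightarrow> (\<forall>n w. (deriv ^^ n) f differentiable (at w))"

definition C3 :: "(real \<Rightarrow> real) \<Rightarrow> bool" where
  "C3 W \<longleftrightarrow> (\<forall>n<3. \<forall>w. (deriv ^^ n) W differentiable (at w)) \<and> continuous_on UNIV ((deriv ^^ 3) W)"

definition L2_norm_on :: "real \<Rightarrow> real \<Rightarrow> (real \<Rightarrow> real) \<Rightarrow> real" where
  "L2_norm_on a b g = sqrt (integral {a..b} (\<lambda>y. (g y)\<^sup>2))"

definition L4_norm_on :: "real \<Rightarrow> real \<Rightarrow> (real \<Rightarrow> real) \<Rightarrow> real" where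
  "L4_norm_on a b g = root 4 (integral {a..b} (\<lambda>y. (g y) ^ 4))"


section \<open>Mesh and broken polynomial space\<close>

text \<open>
  The edges of the mesh are indexed by \<open>0, \<dots>, N\<close>: \<open>x j\<close> stands for $x_{j+1/2}$, so that
  the cell $I_j$ is \<open>{x (j - 1)..x j}\<close> for \<open>j = 1, \<dots>, N\<close>.  All quantities attached to an
  edge (traces, numerical fluxes, \<open>H\<close>) use the same indexing.
\<close>

definition mesh :: "nat \<Rightarrow> (nat \<Rightarrow> real) \<Rightarrow> bool" where
  "mesh N x \<longleftrightarrow> 1 \<le> N \<and> (\<forall>j\<in>{1..N}. x (j - 1) < x j)"

definition cell :: "(nat \<Rightarrow> real) \<Rightarrow> nat \<Rightarrow> real set" where
  "cell x j = {x (j - 1)..x j}"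

text \<open>
  A function that is a polynomial on every cell is given by the family of its restrictions:
  \<open>v j\<close> is the polynomial that represents it on $I_j$.  (Its value as an $L^2$ function at an
  edge is irrelevant, and its one-sided traces are the values of the two adjacent polynomials.)
  Entries outside \<open>{1..N}\<close> carry no meaning.
\<close>

type_synonym dg_fun = "nat \<Rightarrow> real poly"

definition dg_space :: "nat \<Rightarrow> nat \<Rightarrow> dg_fun set" where
  "dg_space N k = {v. \<forall>j\<in>{1..N}. degree (v j) \<le> k}"

text \<open>\<open>bl\<close> and \<open>br\<close> are the exterior traces that the boundary conditions supply at the left and at
  the right end-point of the domain.\<close>

definition trace_minus :: "(nat \<Rightarrow> real) \<Rightarrow> real \<Rightarrow> dg_fun \<Rightarrow> nat \<Rightarrow> real" where
  "trace_minus x bl v j = (if j = 0 then bl else poly (v j) (x j))"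

definition trace_plus :: "nat \<Rightarrow> (nat \<Rightarrow> real) \<Rightarrow> real \<Rightarrow> dg_fun \<Rightarrow> nat \<Rightarrow> real" where
  "trace_plus N x br v j = (if j = N then br else poly (v (j + 1)) (x j))"

definition cell_avg :: "real \<Rightarrow> real \<Rightarrow> real poly \<Rightarrow> real" where
  "cell_avg a b p = integral {a..b} (poly p) / (b - a)"

text \<open>
  The $L^2$ projection onto the broken polynomial space acts cell by cell; this is its action on
  the cell \<open>{a..b}\<close>.
\<close>

definition L2_proj :: "nat \<Rightarrow> real \<Rightarrow> real \<Rightarrow> (real \<Rightarrow> real) \<Rightarrow> real poly" where
  "L2_proj k a b g = (THE q. degree q \<le> k \<and>
     (\<forall>r. degree r \<le> k \<longrightarrow> integral {a..b} (\<lambda>y. (g y - poly q y) * poly r y) = 0))"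


section \<open>Numerical fluxes\<close>

definition E_flux :: "(real \<Rightarrow> real) \<Rightarrow> (real \<Rightarrow> real \<Rightarrow> real) \<Rightarrow> bool" where
  "E_flux f fhat \<longleftrightarrow>
     (\<forall>w. fhat w w = f w) \<and>
     (\<forall>z. \<exists>e>0. \<exists>L. L-lipschitz_on (ball z e) (\<lambda>(um, up). fhat um up)) \<and>
     (\<forall>um up. \<forall>w\<in>closed_segment um up. (fhat um up - f w) * (up - um) \<le> 0)"

definition num_flux ::
  "nat \<Rightarrow> (nat \<Rightarrow> real) \<Rightarrow> (real \<Rightarrow> real \<Rightarrow> real) \<Rightarrow> real \<Rightarrow> real \<Rightarrow> dg_fun \<Rightarrow> nat \<Rightarrow> real" where
  "num_flux N x fhat bl br v j = fhat (trace_minus x bl v j) (trace_plus N x br v j)"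

definition H_plus ::
  "nat \<Rightarrow> (nat \<Rightarrow> real) \<Rightarrow> (real \<Rightarrow> real) \<Rightarrow> (real \<Rightarrow> real \<Rightarrow> real) \<Rightarrow> real \<Rightarrow> real \<Rightarrow> dg_fun \<Rightarrow> nat \<Rightarrow> real" where
  "H_plus N x f fhat bl br v j = num_flux N x fhat bl br v j - f (trace_plus N x br v j)"

definition H_minus ::
  "nat \<Rightarrow> (nat \<Rightarrow> real) \<Rightarrow> (real \<Rightarrow> real) \<Rightarrow> (real \<Rightarrow> real \<Rightarrow> real) \<Rightarrow> real \<Rightarrow> real \<Rightarrow> dg_fun \<Rightarrow> nat \<Rightarrow> real" where
  "H_minus N x f fhat bl br v j = - num_flux N x fhat bl br v j + f (trace_minus x bl v j)"

definition entropy_flux :: "(real \<Rightarrow> real) \<Rightarrow> (real \<Rightarrow> real) \<Rightarrow> (real \<Rightarrow> real) \<Rightarrow> bool" where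
  "entropy_flux f V F \<longleftrightarrow> (\<forall>w. (F has_real_derivative deriv V w * deriv f w) (at w))"

definition entropy_potential ::
  "(real \<Rightarrow> real) \<Rightarrow> (real \<Rightarrow> real) \<Rightarrow> (real \<Rightarrow> real) \<Rightarrow> real \<Rightarrow> real" where
  "entropy_potential f V F w = deriv V w * f w - F w"

definition num_entropy_flux ::
  "nat \<Rightarrow> (nat \<Rightarrow> real) \<Rightarrow> (real \<Rightarrow> real) \<Rightarrow> (real \<Rightarrow> real \<Rightarrow> real) \<Rightarrow> (real \<Rightarrow> real) \<Rightarrow> (real \<Rightarrow> real) \<Rightarrow>
     real \<Rightarrow> real \<Rightarrow> dg_fun \<Rightarrow> nat \<Rightarrow> real" where
  "num_entropy_flux N x f fhat V F bl br v j =
     deriv V (trace_minus x bl v j) * num_flux N x fhat bl br v j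
       - entropy_potential f V F (trace_minus x bl v j)"


section \<open>Constants and damping coefficient\<close>

text \<open>
  The constants depend on \<open>k\<close> only, so their defining inequalities are required on every
  nondegenerate cell \<open>{a..b}\<close> and not just on the cells of one mesh.
\<close>

definition inverse_const :: "nat \<Rightarrow> real \<Rightarrow> bool" where
  "inverse_const k C \<longleftrightarrow> 0 < C \<and>
     (\<forall>a b p. a < b \<longrightarrow> degree p \<le> k \<longrightarrow>
        L4_norm_on a b (poly p) \<le> sqrt C * (b - a) powr (- 1 / 4) * L2_norm_on a b (poly p))"

definition optimal_inverse_const :: "nat \<Rightarrow> real \<Rightarrow> bool" where
  "optimal_inverse_const k C \<longleftrightarrow> inverse_const k C \<and> (\<forall>C'. inverse_const k C' \<longrightarrow> C \<le> C')"

definition admissible_beta :: "nat \<Rightarrow> real \<Rightarrow> bool" where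
  "admissible_beta k \<beta> \<longleftrightarrow>
     (\<forall>a b p W. a < b \<longrightarrow> degree p \<le> k \<longrightarrow> C3 W \<longrightarrow>
        (\<forall>e\<in>{a, b}.
           \<bar>poly (L2_proj k a b (\<lambda>y. deriv W (poly p y) - deriv W (poly p e))) e\<bar>
             \<le> \<beta> / (2 * (b - a)) * (SUP y\<in>{a..b}. \<bar>(deriv ^^ 3) W (poly p y)\<bar>)
                * integral {a..b} (\<lambda>y. \<bar>poly p y - cell_avg a b p\<bar>\<^sup>2)))"

definition damping ::
  "nat \<Rightarrow> real \<Rightarrow> real \<Rightarrow> nat \<Rightarrow> (nat \<Rightarrow> real) \<Rightarrow> (real \<Rightarrow> real) \<Rightarrow> (real \<Rightarrow> real \<Rightarrow> real) \<Rightarrow> (real \<Rightarrow> real) \<Rightarrow>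
     real \<Rightarrow> real \<Rightarrow> dg_fun \<Rightarrow> nat \<Rightarrow> real" where
  "damping k C \<beta> N x f fhat U bl br v j =
     (let a = x (j - 1); b = x j; h = b - a;
          fx = deriv (\<lambda>y. f (poly (v j) y))
      in (SUP y\<in>{a..b}. \<bar>(deriv ^^ 3) U (poly (v j) y)\<bar>) / (INF w. (deriv ^^ 2) U w) *
         (C / (2 * sqrt h) * L2_norm_on a b (\<lambda>y. fx y - poly (L2_proj k a b fx) y) +
          \<beta> / (2 * h) * (\<bar>H_plus N x f fhat bl br v (j - 1)\<bar> + \<bar>H_minus N x f fhat bl br v j\<bar>)))"


section \<open>Scheme B\<close>

text \<open>
  \<open>u t\<close> is the approximate solution at time \<open>t\<close>, and \<open>bl\<close> and \<open>br\<close> are now functions of time.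
  At an end-point of the time interval \<open>T\<close> that belongs to \<open>T\<close> the time derivative is one-sided.
\<close>

definition scheme_B_solution ::
  "nat \<Rightarrow> real \<Rightarrow> real \<Rightarrow> nat \<Rightarrow> (nat \<Rightarrow> real) \<Rightarrow> (real \<Rightarrow> real) \<Rightarrow> (real \<Rightarrow> real \<Rightarrow> real) \<Rightarrow> (real \<Rightarrow> real) \<Rightarrow>
     real set \<Rightarrow> (real \<Rightarrow> real) \<Rightarrow> (real \<Rightarrow> real) \<Rightarrow> (real \<Rightarrow> dg_fun) \<Rightarrow> bool" where
  "scheme_B_solution k C \<beta> N x f fhat U T bl br u \<longleftrightarrow>
     (\<forall>t\<in>T. u t \<in> dg_space N k \<and>
        (\<forall>j\<in>{1..N}.
           (\<forall>y\<in>cell x j. (\<lambda>s. poly (u s j) y) differentiable (at t within T)) \<and>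
           (\<forall>v\<in>dg_space N k.
              integral (cell x j) (\<lambda>y. vector_derivative (\<lambda>s. poly (u s j) y) (at t within T) * poly (v j) y)
              - integral (cell x j) (\<lambda>y. f (poly (u t j) y) * poly (pderiv (v j)) y)
              + num_flux N x fhat (bl t) (br t) (u t) j * poly (v j) (x j)
              - num_flux N x fhat (bl t) (br t) (u t) (j - 1) * poly (v j) (x (j - 1))
              = - damping k C \<beta> N x f fhat U (bl t) (br t) (u t) j *
                  integral (cell x j)
                    (\<lambda>y. (poly (u t j) y - cell_avg (x (j - 1)) (x j) (u t j)) * poly (v j) y))))"

definition local_entropy_inequality ::
  "nat \<Rightarrow> (nat \<Rightarrow> real) \<Rightarrow> (real \<Rightarrow> real) \<Rightarrow> (real \<Rightarrow> real \<Rightarrow> real) \<Rightarrow> (real \<Rightarrow> real) \<Rightarrow> (real \<Rightarrow> real) \<Rightarrow>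
     real set \<Rightarrow> (real \<Rightarrow> real) \<Rightarrow> (real \<Rightarrow> real) \<Rightarrow> (real \<Rightarrow> dg_fun) \<Rightarrow> real \<Rightarrow> nat \<Rightarrow> bool" where
  "local_entropy_inequality N x f fhat V F T bl br u t j \<longleftrightarrow>
     (\<exists>D. ((\<lambda>s. integral (cell x j) (\<lambda>y. V (poly (u s j) y))) has_real_derivative D) (at t within T) \<and>
        D + num_entropy_flux N x f fhat V F (bl t) (br t) (u t) j
          - num_entropy_flux N x f fhat V F (bl t) (br t) (u t) (j - 1) \<le> 0)"


section \<open>Even power series\<close>

text \<open>The series starts at $w^2$; the coefficient \<open>b 0\<close> is not used.\<close>

definition even_series :: "(nat \<Rightarrow> real) \<Rightarrow> real \<Rightarrow> real" where
  "even_series b w = (\<Sum>i. b (Suc i) * w ^ (2 * Suc i))"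

definition entropy_family :: "(nat \<Rightarrow> real) \<Rightarrow> (real \<Rightarrow> real) set" where
  "entropy_family a = {even_series b |b. a 1 \<le> b 1 \<and> (\<forall>i>1. 0 \<le> b i \<and> b i \<le> a i)}"

end

theory Submission
  imports Defs
begin

text \<open>
  Scheme B tests only with polynomials, so the entropy variable \<open>V'(u)\<close> has to be replaced by its $L^2$
  projection onto the polynomials of degree at most \<open>k\<close> on the cell.  If this replacement were exact, the
  scheme would reproduce the entropy balance, with the E-flux condition giving the right sign
  at the left edge of the cell (\<open>E_flux_potential_jump\<close>).  The projection causes three errors: a volume term,
  which is the pairing of the projection residuals of $f(u)_x$ and \<open>V'(u)\<close> (\<open>weak_flux_identity\<close>), and
  one term at each edge, which is \<open>H\<close> times the error in the trace of \<open>V'(u)\<close>.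

  All three errors are quadratic in the fluctuation of \<open>u\<close> about its cell average, with a factor
  $\max|V'''(u)|$: the volume term because the linearisation of \<open>V'\<close> about the average is reproduced by
  the projection (\<open>entropy_variable_projection_error\<close>, where the inverse inequality enters), the edge
  terms by the property that defines \<open>\<beta>\<close> (\<open>trace_projection_error\<close>).  The damping term dissipates the
  same quadratic quantity with factor $\min V''$ (\<open>damping_dissipation\<close>), and its coefficient is chosen
  such that it dominates.

  Consequently damping built from \<open>U\<close> works for every \<open>V\<close> with $V'' \ge \min U''$ and
  $|V'''| \le |U'''|$ (\<open>local_entropy_inequality_of_dominated_entropy\<close>).  For even power series with
  nonnegative coefficients both conditions can be read off the coefficients: $\min U'' = 2 a_1$ is attained
  at 0 and $V'' \ge 2 b_1$ (\<open>second_deriv_even_series\<close>), and the absolute value of the third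
  derivative is monotone in the coefficients of index at least 2 and independent of the first one
  (\<open>third_deriv_even_series_mono\<close>).
\<close>

section \<open>The $L^2$ projection onto polynomials\<close>

lemma integral_Cauchy_Schwarz:
  fixes g h :: "real \<Rightarrow> real"
  assumes ab: "a < b" and cg: "continuous_on {a..b} g" and ch: "continuous_on {a..b} h"
  shows "\<bar>integral {a..b} (\<lambda>y. g y * h y)\<bar> \<le> L2_norm_on a b g * L2_norm_on a b h"
proof -
  define A B D where "A = integral {a..b} (\<lambda>y. (g y)\<^sup>2)"
    and "B = integral {a..b} (\<lambda>y. g y * h y)" and "D = integral {a..b} (\<lambda>y. (h y)\<^sup>2)"
  have D0: "D \<ge> 0" unfolding D_def by (rule integral_nonneg) (auto intro!: integrable_continuous_real continuous_intros ch)
  have "B\<^sup>2 \<le> A * D"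
  proof (cases "D = 0")
    case True
    then have "\<forall>y\<in>{a..b}. (h y)\<^sup>2 = 0"
      unfolding D_def by (rule iffD1[OF integral_eq_0_iff, rotated 3])
        (use ab ch in \<open>auto intro!: continuous_intros\<close>)
    then have "B = integral {a..b} (\<lambda>y. 0)"
      unfolding B_def by (intro integral_cong) auto
    then show ?thesis using True by simp
  next
    case False
    have "0 \<le> integral {a..b} (\<lambda>y. (D * g y - B * h y)\<^sup>2)"
      by (rule integral_nonneg) (auto intro!: integrable_continuous_real continuous_intros cg ch)
    also have "\<dots> = integral {a..b} (\<lambda>y. D\<^sup>2 * (g y)\<^sup>2 - 2 * D * B * (g y * h y) + B\<^sup>2 * (h y)\<^sup>2)"
      by (simp add: power2_eq_square algebra_simps)
    also have "\<dots> = D\<^sup>2 * A - 2 * D * B * B + B\<^sup>2 * D"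
      unfolding A_def B_def D_def
      by (subst integral_add integral_diff integral_mult_right,
          auto intro!: integrable_continuous_real continuous_intros cg ch)+
    also have "\<dots> = D * (A * D - B\<^sup>2)"
      by (simp add: power2_eq_square algebra_simps)
    finally show ?thesis using False D0 by (simp add: zero_le_mult_iff)
  qed
  then have "sqrt (B\<^sup>2) \<le> sqrt (A * D)" by (rule real_sqrt_le_mono)
  then show ?thesis
    by (simp add: A_def B_def D_def L2_norm_on_def real_sqrt_mult)
qed

lemma poly_eq_0_if_zero_on_interval:
  fixes p :: "real poly"
  assumes "a < b" "\<And>y. y \<in> {a..b} \<Longrightarrow> poly p y = 0"
  shows "p = 0"
proof (rule ccontr)
  assume "p \<noteq> 0"
  then have "finite {y. poly p y = 0}" by (rule poly_roots_finite)
  moreover have "{a..b} \<subseteq> {y. poly p y = 0}" using assms by auto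
  ultimately show False using infinite_Icc[OF assms(1)] finite_subset by blast
qed

lemma integral_poly_square_eq_0:
  fixes p :: "real poly"
  assumes "a < b" "integral {a..b} (\<lambda>y. poly p y * poly p y) = 0"
  shows "p = 0"
proof (rule poly_eq_0_if_zero_on_interval[OF assms(1)])
  have "\<forall>y\<in>{a..b}. poly p y * poly p y = 0"
    by (rule iffD1[OF integral_eq_0_iff, rotated 3]) (use assms in \<open>auto intro!: continuous_intros\<close>)
  then show "\<And>y. y \<in> {a..b} \<Longrightarrow> poly p y = 0" by auto
qed

text \<open>
  This is one step of the Gram--Schmidt process per dimension: the residual \<open>e\<close> of the monomial
  $y^n$ is orthogonal to all lower degrees, so adding the component of \<open>g\<close> along \<open>e\<close> extends the
  projection by one degree.  The degree is bounded through vanishing coefficients so that the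
  induction can start from the zero space, which no bound on \<open>degree\<close> describes.
\<close>

lemma orthogonal_projection_exists:
  fixes g :: "real \<Rightarrow> real"
  assumes ab: "a < b" and "continuous_on {a..b} g"
  shows "\<exists>q. (\<forall>i\<ge>n. coeff q i = 0) \<and>
    (\<forall>r. (\<forall>i\<ge>n. coeff r i = 0) \<longrightarrow> integral {a..b} (\<lambda>y. (g y - poly q y) * poly r y) = 0)"
  using assms(2)
proof (induction n arbitrary: g)
  case 0
  have "poly r y = 0" if "\<forall>i. coeff r i = 0" for r :: "real poly" and y
    using that by (simp add: poly_altdef)
  then show ?case by (intro exI[of _ 0]) auto
next
  case (Suc n)
  note cg = Suc.prems
  obtain m where m: "\<forall>i\<ge>n. coeff m i = 0"
    and mo: "\<And>r. \<forall>i\<ge>n. coeff r i = 0 \<Longrightarrow>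
      integral {a..b} (\<lambda>y. (poly (monom 1 n) y - poly m y) * poly r y) = 0"
    using Suc.IH[of "poly (monom 1 n)", OF continuous_on_poly[OF continuous_on_id]] by blast
  obtain q where q: "\<forall>i\<ge>n. coeff q i = 0"
    and qo: "\<And>r. \<forall>i\<ge>n. coeff r i = 0 \<Longrightarrow>
      integral {a..b} (\<lambda>y. (g y - poly q y) * poly r y) = 0"
    using Suc.IH[of g] Suc.prems by auto
  define e where "e = monom 1 n - m"
  have e1: "coeff e n = 1" using m by (simp add: e_def)
  have eS: "\<forall>i\<ge>Suc n. coeff e i = 0" using m by (simp add: e_def)
  have eo: "integral {a..b} (\<lambda>y. poly e y * poly r y) = 0" if "\<forall>i\<ge>n. coeff r i = 0" for r
    using mo[OF that] by (simp add: e_def)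
  define E where "E = integral {a..b} (\<lambda>y. poly e y * poly e y)"
  have E0: "E \<noteq> 0" using integral_poly_square_eq_0[OF ab, of e] e1 unfolding E_def by auto
  define c where "c = integral {a..b} (\<lambda>y. (g y - poly q y) * poly e y) / E"
  show ?case
  proof (intro exI[of _ "q + smult c e"] conjI allI impI)
    fix i assume "i \<ge> Suc n"
    then show "coeff (q + smult c e) i = 0" using q eS by simp
  next
    fix r :: "real poly" assume r: "\<forall>i\<ge>Suc n. coeff r i = 0"
    \<comment> \<open>Split off the leading term of \<open>r\<close> along \<open>e\<close>; the rest has lower degree.\<close>
    define d r' where "d = coeff r n" and "r' = r - smult d e"
    have r': "\<forall>i\<ge>n. coeff r' i = 0"
    proof (intro allI impI)
      fix i assume "i \<ge> n"
      then show "coeff r' i = 0"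
        by (cases "i = n") (use r eS e1 in \<open>auto simp: r'_def d_def\<close>)
    qed
    have rr: "r = r' + smult d e" by (simp add: r'_def)
    have "integral {a..b} (\<lambda>y. (g y - poly (q + smult c e) y) * poly r y)
       = integral {a..b} (\<lambda>y. (g y - poly q y) * poly r' y - c * (poly e y * poly r' y)
            + d * ((g y - poly q y) * poly e y) - d * c * (poly e y * poly e y))"
      by (subst rr) (simp add: algebra_simps)
    also have "\<dots> = integral {a..b} (\<lambda>y. (g y - poly q y) * poly r' y)
         - c * integral {a..b} (\<lambda>y. poly e y * poly r' y)
         + d * integral {a..b} (\<lambda>y. (g y - poly q y) * poly e y) - d * c * E"
      unfolding E_def
      by (subst integral_add integral_diff integral_mult_right,
          auto intro!: integrable_continuous_real continuous_intros cg)+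
    also have "\<dots> = 0" using qo[OF r'] eo[OF r'] E0 by (simp add: c_def)
    finally show "integral {a..b} (\<lambda>y. (g y - poly (q + smult c e) y) * poly r y) = 0" .
  qed
qed

lemma degree_le_iff_coeff_Suc: "degree p \<le> k \<longleftrightarrow> (\<forall>i\<ge>Suc k. coeff p i = 0)"
  by (auto simp: Suc_le_eq intro: degree_le coeff_eq_0)

lemma
  fixes g :: "real \<Rightarrow> real"
  assumes ab: "a < b" and cg: "continuous_on {a..b} g"
  shows degree_L2_proj: "degree (L2_proj k a b g) \<le> k"
    and L2_proj_orthogonal: "\<And>r. degree r \<le> k \<Longrightarrow>
      integral {a..b} (\<lambda>y. (g y - poly (L2_proj k a b g) y) * poly r y) = 0"
    and L2_proj_unique: "\<And>q. degree q \<le> k \<Longrightarrow>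
      (\<And>r. degree r \<le> k \<Longrightarrow> integral {a..b} (\<lambda>y. (g y - poly q y) * poly r y) = 0) \<Longrightarrow>
      L2_proj k a b g = q"
proof -
  let ?P = "\<lambda>q. degree q \<le> k \<and>
     (\<forall>r. degree r \<le> k \<longrightarrow> integral {a..b} (\<lambda>y. (g y - poly q y) * poly r y) = 0)"
  have ex: "\<exists>q. ?P q"
    using orthogonal_projection_exists[OF ab cg, of "Suc k"] by (simp only: degree_le_iff_coeff_Suc)
  have un: "q = q'" if "?P q" "?P q'" for q q'
  proof -
    let ?d = "q - q'"
    have d: "degree ?d \<le> k" using that by (auto intro: degree_diff_le)
    have "integral {a..b} (\<lambda>y. poly ?d y * poly ?d y)
      = integral {a..b} (\<lambda>y. (g y - poly q' y) * poly ?d y - (g y - poly q y) * poly ?d y)"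
      by (simp add: algebra_simps)
    also have "\<dots> = integral {a..b} (\<lambda>y. (g y - poly q' y) * poly ?d y)
          - integral {a..b} (\<lambda>y. (g y - poly q y) * poly ?d y)"
      by (rule integral_diff) (auto intro!: integrable_continuous_real continuous_intros cg)
    also have "\<dots> = 0" using that d by (simp del: poly_diff)
    finally have "?d = 0" by (rule integral_poly_square_eq_0[OF ab])
    then show ?thesis by simp
  qed
  have *: "\<exists>!q. ?P q" using ex un by blast
  have P: "?P (L2_proj k a b g)" unfolding L2_proj_def by (rule theI'[OF *])
  show "degree (L2_proj k a b g) \<le> k" using P by blast
  show "\<And>r. degree r \<le> k \<Longrightarrow>
      integral {a..b} (\<lambda>y. (g y - poly (L2_proj k a b g) y) * poly r y) = 0" using P by blast
  show "\<And>q. degree q \<le> k \<Longrightarrow>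
      (\<And>r. degree r \<le> k \<Longrightarrow> integral {a..b} (\<lambda>y. (g y - poly q y) * poly r y) = 0) \<Longrightarrow>
      L2_proj k a b g = q" using un P by blast
qed

lemma integral_mult_L2_proj:
  assumes ab: "a < b" and cg: "continuous_on {a..b} g" and r: "degree r \<le> k"
  shows "integral {a..b} (\<lambda>y. g y * poly r y) = integral {a..b} (\<lambda>y. poly (L2_proj k a b g) y * poly r y)"
proof -
  have "integral {a..b} (\<lambda>y. g y * poly r y) - integral {a..b} (\<lambda>y. poly (L2_proj k a b g) y * poly r y)
     = integral {a..b} (\<lambda>y. g y * poly r y - poly (L2_proj k a b g) y * poly r y)"
    by (rule integral_diff[symmetric]) (auto intro!: integrable_continuous_real continuous_intros cg)
  also have "\<dots> = 0" using L2_proj_orthogonal[OF ab cg r] by (simp add: left_diff_distrib)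
  finally show ?thesis by simp
qed

lemma L2_proj_diff_const:
  assumes ab: "a < b" and cg: "continuous_on {a..b} g"
  shows "L2_proj k a b (\<lambda>y. g y - c) = L2_proj k a b g - [:c:]"
proof (rule L2_proj_unique[OF ab])
  show "continuous_on {a..b} (\<lambda>y. g y - c)" by (intro continuous_intros cg)
  show "degree (L2_proj k a b g - [:c:]) \<le> k"
    using degree_L2_proj[OF ab cg, of k] by (intro degree_diff_le) auto
  show "integral {a..b} (\<lambda>y. (g y - c - poly (L2_proj k a b g - [:c:]) y) * poly r y) = 0"
    if "degree r \<le> k" for r
    using L2_proj_orthogonal[OF ab cg that] by simp
qed

lemma L2_proj_best_approximation:
  assumes ab: "a < b" and cg: "continuous_on {a..b} g" and r: "degree r \<le> k"
  shows "L2_norm_on a b (\<lambda>y. g y - poly (L2_proj k a b g) y) \<le> L2_norm_on a b (\<lambda>y. g y - poly r y)"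
proof -
  let ?q = "L2_proj k a b g"
  let ?d = "?q - r"
  have d: "degree ?d \<le> k" using r degree_L2_proj[OF ab cg, of k] by (intro degree_diff_le)
  have "integral {a..b} (\<lambda>y. (g y - poly r y)\<^sup>2)
    = integral {a..b} (\<lambda>y. (g y - poly ?q y)\<^sup>2 + 2 * ((g y - poly ?q y) * poly ?d y) + (poly ?d y)\<^sup>2)"
    by (simp add: power2_eq_square algebra_simps)
  also have "\<dots> = integral {a..b} (\<lambda>y. (g y - poly ?q y)\<^sup>2)
      + 2 * integral {a..b} (\<lambda>y. (g y - poly ?q y) * poly ?d y) + integral {a..b} (\<lambda>y. (poly ?d y)\<^sup>2)"
    by (subst integral_add integral_mult_right,
        auto intro!: integrable_continuous_real continuous_intros cg)+
  also have "\<dots> \<ge> integral {a..b} (\<lambda>y. (g y - poly ?q y)\<^sup>2)"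
    using L2_proj_orthogonal[OF ab cg d]
    by (auto intro!: integral_nonneg integrable_continuous_real continuous_intros)
  finally show ?thesis unfolding L2_norm_on_def by (rule real_sqrt_le_mono)
qed

section \<open>Differentiation of the cell integral in time\<close>

lemma Taylor_quadratic_remainder:
  fixes g g' g'' :: "real \<Rightarrow> real"
  assumes g: "\<And>w. (g has_real_derivative g' w) (at w)"
    and g': "\<And>w. (g' has_real_derivative g'' w) (at w)"
    and S: "\<And>w. w \<in> closed_segment c z \<Longrightarrow> \<bar>g'' w\<bar> \<le> S"
  shows "\<bar>g z - g c - g' c * (z - c)\<bar> \<le> S / 2 * (z - c)\<^sup>2"
proof (cases "z = c")
  case False
  define D where "D = (\<lambda>m::nat. if m = 0 then g else if m = 1 then g' else g'')"
  have "\<exists>w. (if z < c then z < w \<and> w < c else c < w \<and> w < z) \<and>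
      g z = (\<Sum>m<2. D m c / fact m * (z - c) ^ m) + D 2 w / fact 2 * (z - c) ^ 2"
  proof (rule Taylor[where a = "min c z" and b = "max c z"])
    show "\<forall>m t. m < 2 \<and> min c z \<le> t \<and> t \<le> max c z \<longrightarrow> DERIV (D m) t :> D (Suc m) t"
      using g g' by (auto simp: D_def less_2_cases_iff)
  qed (use False in \<open>auto simp: D_def\<close>)
  then obtain w where w: "if z < c then z < w \<and> w < c else c < w \<and> w < z"
    and eq: "g z = (\<Sum>m<2. D m c / fact m * (z - c) ^ m) + D 2 w / fact 2 * (z - c) ^ 2"
    by blast
  have "w \<in> closed_segment c z"
    using w by (auto simp: closed_segment_eq_real_ivl split: if_splits)
  then have Sw: "\<bar>g'' w\<bar> \<le> S" by (rule S)
  have "g z - g c - g' c * (z - c) = g'' w / 2 * (z - c)\<^sup>2"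
    using eq by (simp add: D_def numeral_2_eq_2)
  then have "\<bar>g z - g c - g' c * (z - c)\<bar> = \<bar>g'' w\<bar> / 2 * (z - c)\<^sup>2"
    by (simp only: abs_mult abs_divide abs_power2 abs_numeral)
  also have "\<dots> \<le> S / 2 * (z - c)\<^sup>2"
    using Sw by (intro mult_right_mono) auto
  finally show ?thesis .
qed simp

definition Lagrange_poly :: "real set \<Rightarrow> real \<Rightarrow> real poly" where
  "Lagrange_poly B z = (\<Prod>w\<in>B - {z}. smult (1 / (z - w)) [:- w, 1:])"

lemma poly_Lagrange_poly:
  assumes "finite B" "z \<in> B" "y \<in> B"
  shows "poly (Lagrange_poly B z) y = (if y = z then 1 else 0)"
  using assms by (auto simp: Lagrange_poly_def poly_prod simp flip: diff_divide_distrib intro!: prod.neutral)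

lemma degree_Lagrange_poly:
  assumes "finite B" "z \<in> B"
  shows "degree (Lagrange_poly B z) < card B"
proof -
  have "degree (Lagrange_poly B z) \<le> (\<Sum>w\<in>B - {z}. degree (smult (1 / (z - w)) [:- w, 1:]))"
    unfolding Lagrange_poly_def using assms(1)
    by (intro degree_prod_sum_le[THEN order_trans]) (auto simp: o_def)
  also have "\<dots> \<le> (\<Sum>w\<in>B - {z}. 1)"
    by (rule sum_mono) (auto intro: order_trans[OF degree_smult_le])
  also have "\<dots> < card B"
    using assms by (metis card_Diff1_less sum.neutral_const card_eq_sum)
  finally show ?thesis .
qed

lemma Lagrange_interpolation:
  assumes B: "finite B" and p: "degree p < card B"
  shows "poly p y = (\<Sum>z\<in>B. poly p z * poly (Lagrange_poly B z) y)"
proof -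
  let ?q = "\<Sum>z\<in>B. smult (poly p z) (Lagrange_poly B z)"
  have "degree ?q < card B"
    using B p by (intro degree_sum_less)
      (auto intro: le_less_trans[OF degree_smult_le] degree_Lagrange_poly simp del: degree_smult_eq)
  moreover have "poly p w = poly ?q w" if "w \<in> B" for w
  proof -
    have "poly ?q w = (\<Sum>z\<in>B. if w = z then poly p z else 0)"
      unfolding poly_sum by (rule sum.cong) (use B that in \<open>auto simp: poly_Lagrange_poly\<close>)
    then show ?thesis using B that by simp
  qed
  ultimately have "p = ?q" using p by (intro poly_eqI_degree[of B])
  then show ?thesis by (metis (no_types, lifting) poly_smult poly_sum sum.cong)
qed

text \<open>
  The discrete solution is only known to be differentiable in time at each point of the cell, with no
  continuity of the time derivative.  Interpolation at \<open>k + 1\<close> nodes turns this into a statement about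
  finitely many scalar functions of time: the solution is a combination of fixed Lagrange polynomials
  whose coefficients are its nodal values.  Hence its time derivative is again a polynomial of degree
  at most \<open>k\<close>, which is what allows the projection to be moved onto \<open>V'\<close> later, and the
  difference quotients converge uniformly on the cell.  The quadratic Taylor remainder of \<open>V\<close> then
  vanishes to second order in the time increment, so the integral can be differentiated under the
  integral sign.
\<close>

lemma has_real_derivative_integral_poly:
  fixes P :: "real \<Rightarrow> real poly" and V V' V'' :: "real \<Rightarrow> real"
  assumes ab: "a < b" and t: "t \<in> T" and nontriv: "at t within T \<noteq> bot"
    and deg: "\<And>s. s \<in> T \<Longrightarrow> degree (P s) \<le> k"
    and diff: "\<And>y. y \<in> {a..b} \<Longrightarrow> (\<lambda>s. poly (P s) y) differentiable (at t within T)"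
    and V: "\<And>w. (V has_real_derivative V' w) (at w)"
    and V': "\<And>w. (V' has_real_derivative V'' w) (at w)"
    and V'': "continuous_on UNIV V''"
  obtains R where "degree R \<le> k"
    and "\<And>y. vector_derivative (\<lambda>s. poly (P s) y) (at t within T) = poly R y"
    and "((\<lambda>s. integral {a..b} (\<lambda>y. V (poly (P s) y))) has_real_derivative
           integral {a..b} (\<lambda>y. V' (poly (P t) y) * poly R y)) (at t within T)"
proof -
  obtain B where B: "finite B" "card B = Suc k" "B \<subseteq> {a..b}"
    using infinite_arbitrarily_large[OF infinite_Icc[OF ab]] by blast
  define L where "L = Lagrange_poly B"
  define c where "c = (\<lambda>z s. poly (P s) z)"
  define c' where "c' = (\<lambda>z. vector_derivative (c z) (at t within T))"
  define R where "R = (\<Sum>z\<in>B. smult (c' z) (L z))"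
  have Peq: "poly (P s) y = (\<Sum>z\<in>B. c z s * poly (L z) y)" if "s \<in> T" for s y
    using Lagrange_interpolation[OF B(1), of "P s" y] deg[OF that] B(2) by (simp add: L_def c_def)
  have dc: "(c z has_real_derivative c' z) (at t within T)" if "z \<in> B" for z
    using diff[of z] that B(3) unfolding c_def c'_def has_real_derivative_iff_has_vector_derivative
    by (auto simp flip: vector_derivative_works)
  have "degree R \<le> k"
    unfolding R_def
  proof (rule degree_sum_le[OF B(1)])
    fix z assume "z \<in> B"
    then show "degree (smult (c' z) (L z)) \<le> k"
      using degree_Lagrange_poly[OF B(1), of z] B(2) degree_smult_le[of "c' z" "L z"]
      by (simp add: L_def)
  qed
  moreover have "vector_derivative (\<lambda>s. poly (P s) y) (at t within T) = poly R y" for y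
  proof -
    have "((\<lambda>s. \<Sum>z\<in>B. c z s * poly (L z) y) has_real_derivative poly R y) (at t within T)"
      unfolding R_def poly_sum by (auto intro!: derivative_eq_intros dc)
    then have "((\<lambda>s. poly (P s) y) has_real_derivative poly R y) (at t within T)"
      by (rule has_field_derivative_transform_within[OF _ zero_less_one t]) (simp add: Peq)
    then show ?thesis
      unfolding has_real_derivative_iff_has_vector_derivative
      by (rule vector_derivative_within[OF nontriv])
  qed
  moreover have "((\<lambda>s. integral {a..b} (\<lambda>y. V (poly (P s) y))) has_real_derivative
           integral {a..b} (\<lambda>y. V' (poly (P t) y) * poly R y)) (at t within T)"
  proof -
    have cV: "continuous_on UNIV V" and cV': "continuous_on UNIV V'"
      using V V' by (auto intro!: DERIV_continuous_on)
    note ci = continuous_on_compose2[OF cV] continuous_on_compose2[OF cV']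
    define w where "w = (\<lambda>z. integral {a..b} (\<lambda>y. V' (poly (P t) y) * poly (L z) y))"
    define \<Phi> where "\<Phi> = (\<lambda>s. integral {a..b} (\<lambda>y. V (poly (P s) y)))"
    \<comment> \<open>The deviation of \<open>\<Phi>\<close> from its linearisation in the nodal values, to be shown of order \<open>(s - t)\<^sup>2\<close>.\<close>
    define e where "e = (\<lambda>s. \<Phi> s - \<Phi> t - (\<Sum>z\<in>B. (c z s - c z t) * w z))"
    have Dw: "integral {a..b} (\<lambda>y. V' (poly (P t) y) * poly R y) = (\<Sum>z\<in>B. c' z * w z)"
    proof -
      have "integral {a..b} (\<lambda>y. V' (poly (P t) y) * poly R y)
        = integral {a..b} (\<lambda>y. \<Sum>z\<in>B. c' z * (V' (poly (P t) y) * poly (L z) y))"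
        by (simp add: R_def poly_sum sum_distrib_left mult.left_commute)
      also have "\<dots> = (\<Sum>z\<in>B. integral {a..b} (\<lambda>y. c' z * (V' (poly (P t) y) * poly (L z) y)))"
        using B(1) by (rule integral_sum) (auto intro!: integrable_continuous_real continuous_intros ci)
      finally show ?thesis by (simp add: w_def)
    qed
    have "\<exists>K. \<forall>z\<in>B. \<forall>y\<in>{a..b}. \<bar>poly (L z) y\<bar> \<le> K"
    proof -
      have "\<exists>M. \<forall>y\<in>{a..b}. \<bar>poly (L z) y\<bar> \<le> M" for z
      proof -
        have "compact ((\<lambda>y. poly (L z) y) ` {a..b})"
          by (intro compact_continuous_image continuous_intros) simp
        then show ?thesis using compact_imp_bounded bounded_iff by (metis imageI real_norm_def)
      qed
      then obtain M where M: "\<And>z y. y \<in> {a..b} \<Longrightarrow> \<bar>poly (L z) y\<bar> \<le> M z" by metis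
      show ?thesis
      proof (intro exI ballI)
        fix z y assume "z \<in> B" "y \<in> {a..b}"
        then show "\<bar>poly (L z) y\<bar> \<le> Max (M ` B)"
          using M[of y z] B(1) by (intro order_trans[OF M Max_ge]) auto
      qed
    qed
    then obtain K where K: "\<And>z y. z \<in> B \<Longrightarrow> y \<in> {a..b} \<Longrightarrow> \<bar>poly (L z) y\<bar> \<le> K" by blast
    obtain r where r: "\<And>y. y \<in> {a..b} \<Longrightarrow> \<bar>poly (P t) y\<bar> \<le> r"
    proof -
      have "compact ((\<lambda>y. poly (P t) y) ` {a..b})"
        by (intro compact_continuous_image continuous_intros) simp
      then show ?thesis using compact_imp_bounded bounded_iff that by (metis imageI real_norm_def)
    qed
    obtain M where M: "\<And>v. v \<in> {-r-1..r+1} \<Longrightarrow> \<bar>V'' v\<bar> \<le> M"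
    proof -
      have "compact (V'' ` {-r-1..r+1})"
        using V'' by (intro compact_continuous_image) (auto intro: continuous_on_subset)
      then show ?thesis using compact_imp_bounded bounded_iff that by (metis imageI real_norm_def)
    qed
    \<comment> \<open>\<open>q s * \<bar>s - t\<bar>\<close> bounds the increment of the solution uniformly on the cell, and \<open>q\<close> has a finite
      limit at \<open>t\<close>.  Once the increment is below 1, all values stay in \<open>{-r-1..r+1}\<close>, where \<open>M\<close>
      bounds \<open>V''\<close>.\<close>
    define q where "q = (\<lambda>s. K * (\<Sum>z\<in>B. \<bar>(c z s - c z t) / (s - t)\<bar>))"
    have qlim: "(q \<longlongrightarrow> K * (\<Sum>z\<in>B. \<bar>c' z\<bar>)) (at t within T)"
      unfolding q_def by (intro tendsto_intros) (use dc in \<open>auto simp: has_field_derivative_iff\<close>)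
    have st: "((\<lambda>s. \<bar>s - t\<bar>) \<longlongrightarrow> 0) (at t within T)"
      by (auto intro!: tendsto_eq_intros)
    have "((\<lambda>s. q s * \<bar>s - t\<bar>) \<longlongrightarrow> K * (\<Sum>z\<in>B. \<bar>c' z\<bar>) * 0) (at t within T)"
      by (intro tendsto_mult qlim st)
    then have small: "\<forall>\<^sub>F s in at t within T. q s * \<bar>s - t\<bar> < 1"
      by (rule order_tendstoD) simp
    have bound: "\<bar>e s / (s - t)\<bar> \<le> (M / 2 * (b - a)) * ((q s)\<^sup>2 * \<bar>s - t\<bar>)"
      if sT: "s \<in> T" and sne: "s \<noteq> t" and sm: "q s * \<bar>s - t\<bar> < 1" for s
    proof -
      have dP: "\<bar>poly (P s) y - poly (P t) y\<bar> \<le> q s * \<bar>s - t\<bar>" if y: "y \<in> {a..b}" for y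
      proof -
        have "\<bar>poly (P s) y - poly (P t) y\<bar> = \<bar>\<Sum>z\<in>B. (c z s - c z t) * poly (L z) y\<bar>"
          by (simp add: Peq[OF sT] Peq[OF t] sum_subtractf left_diff_distrib)
        also have "\<dots> \<le> (\<Sum>z\<in>B. \<bar>c z s - c z t\<bar> * K)"
          by (rule order_trans[OF sum_abs sum_mono]) (auto simp: abs_mult intro!: mult_left_mono K y)
        also have "\<dots> = q s * \<bar>s - t\<bar>"
          using sne by (simp add: q_def sum_distrib_left sum_distrib_right mult.commute)
        finally show ?thesis .
      qed
      have "e s = integral {a..b} (\<lambda>y. V (poly (P s) y) - V (poly (P t) y)
           - V' (poly (P t) y) * (poly (P s) y - poly (P t) y))" (is "_ = integral _ ?E")
      proof -
        have "(\<Sum>z\<in>B. (c z s - c z t) * w z)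
          = (\<Sum>z\<in>B. integral {a..b} (\<lambda>y. (c z s - c z t) * (V' (poly (P t) y) * poly (L z) y)))"
          by (simp add: w_def)
        also have "\<dots> = integral {a..b} (\<lambda>y. \<Sum>z\<in>B. (c z s - c z t) * (V' (poly (P t) y) * poly (L z) y))"
          using B(1) by (rule integral_sum[symmetric])
            (auto intro!: integrable_continuous_real continuous_intros ci)
        also have "\<dots> = integral {a..b} (\<lambda>y. V' (poly (P t) y) * (poly (P s) y - poly (P t) y))"
          by (simp add: Peq[OF sT] Peq[OF t] sum_subtractf sum_distrib_left algebra_simps
              flip: sum_subtractf)
        finally have "(\<Sum>z\<in>B. (c z s - c z t) * w z)
          = integral {a..b} (\<lambda>y. V' (poly (P t) y) * (poly (P s) y - poly (P t) y))" .
        then show ?thesis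
          unfolding e_def \<Phi>_def
          by (subst integral_diff integral_diff,
              auto intro!: integrable_continuous_real continuous_intros ci)+
      qed
      also have "\<bar>\<dots>\<bar> \<le> M / 2 * (q s * \<bar>s - t\<bar>)\<^sup>2 * (b - a)"
      proof -
        have "norm (?E y) \<le> M / 2 * (q s * \<bar>s - t\<bar>)\<^sup>2" if y: "y \<in> {a..b}" for y
        proof -
          have seg: "closed_segment (poly (P t) y) (poly (P s) y) \<subseteq> {-r-1..r+1}"
            using r[OF y] dP[OF y] sm by (auto simp: closed_segment_eq_real_ivl split: if_splits)
          then have M0: "0 \<le> M" using M[of "poly (P t) y"] by force
          have "norm (?E y) \<le> M / 2 * (poly (P s) y - poly (P t) y)\<^sup>2"
            unfolding real_norm_def by (rule Taylor_quadratic_remainder[OF V V']) (use seg M in blast)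
          also have "\<dots> \<le> M / 2 * (q s * \<bar>s - t\<bar>)\<^sup>2"
            using M0 dP[OF y] by (intro mult_left_mono abs_le_square_iff[THEN iffD1]) auto
          finally show ?thesis .
        qed
        then have "norm (integral {a..b} ?E) \<le> M / 2 * (q s * \<bar>s - t\<bar>)\<^sup>2 * (b - a)"
          using ab by (intro integral_bound) (auto intro!: continuous_intros ci)
        then show ?thesis by simp
      qed
      finally have "\<bar>e s\<bar> / \<bar>s - t\<bar> \<le> M / 2 * (q s * \<bar>s - t\<bar>)\<^sup>2 * (b - a) / \<bar>s - t\<bar>"
        by (rule divide_right_mono) simp
      also have "\<dots> = (M / 2 * (b - a)) * ((q s)\<^sup>2 * \<bar>s - t\<bar>)"
        using sne by (simp add: power2_eq_square field_simps)
      finally show ?thesis by simp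
    qed
    have "((\<lambda>s. e s / (s - t)) \<longlongrightarrow> 0) (at t within T)"
    proof (rule Lim_null_comparison)
      have "\<forall>\<^sub>F s in at t within T. s \<in> T \<and> s \<noteq> t"
        by (auto simp: eventually_at_filter)
      then show "\<forall>\<^sub>F s in at t within T. norm (e s / (s - t))
          \<le> (M / 2 * (b - a)) * ((q s)\<^sup>2 * \<bar>s - t\<bar>)"
        using small by eventually_elim (use bound in \<open>auto simp del: abs_divide\<close>)
      have "((\<lambda>s. (M / 2 * (b - a)) * ((q s)\<^sup>2 * \<bar>s - t\<bar>)) \<longlongrightarrow>
          (M / 2 * (b - a)) * ((K * (\<Sum>z\<in>B. \<bar>c' z\<bar>))\<^sup>2 * 0)) (at t within T)"
        by (intro tendsto_mult tendsto_power tendsto_const qlim st)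
      then show "((\<lambda>s. (M / 2 * (b - a)) * ((q s)\<^sup>2 * \<bar>s - t\<bar>)) \<longlongrightarrow> 0) (at t within T)"
        by simp
    qed
    then have de: "(e has_real_derivative 0) (at t within T)"
      by (simp add: has_field_derivative_iff e_def)
    have "((\<lambda>s. \<Phi> t + (\<Sum>z\<in>B. (c z s - c z t) * w z) + e s) has_real_derivative
        (\<Sum>z\<in>B. c' z * w z)) (at t within T)"
      by (auto intro!: derivative_eq_intros dc de)
    then show ?thesis by (simp add: e_def Dw \<Phi>_def)
  qed
  ultimately show ?thesis using that by blast
qed

section \<open>Projection errors of the entropy variable\<close>

lemma C3_derivatives:
  assumes "C3 W"
  shows "(W has_real_derivative deriv W w) (at w)"
    and "(deriv W has_real_derivative (deriv ^^ 2) W w) (at w)"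
    and "((deriv ^^ 2) W has_real_derivative (deriv ^^ 3) W w) (at w)"
    and "continuous_on UNIV ((deriv ^^ 3) W)"
proof -
  have "((deriv ^^ n) W has_real_derivative (deriv ^^ Suc n) W w) (at w)" if "n < 3" for n
    using assms that by (simp add: C3_def DERIV_deriv_iff_real_differentiable)
  from this[of 0] this[of 1] this[of 2]
  show "(W has_real_derivative deriv W w) (at w)"
    "(deriv W has_real_derivative (deriv ^^ 2) W w) (at w)"
    "((deriv ^^ 2) W has_real_derivative (deriv ^^ 3) W w) (at w)"
    by (simp_all add: numeral_2_eq_2 numeral_3_eq_3)
  show "continuous_on UNIV ((deriv ^^ 3) W)" using assms by (simp add: C3_def)
qed

lemma C3_continuous:
  assumes "C3 W"
  shows "continuous_on UNIV W" "continuous_on UNIV (deriv W)" "continuous_on UNIV ((deriv ^^ 2) W)"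
  using C3_derivatives[OF assms] by (auto intro!: DERIV_continuous_on)

lemma bdd_above_third_derivative:
  assumes "C3 W"
  shows "bdd_above ((\<lambda>y. \<bar>(deriv ^^ 3) W (poly p y)\<bar>) ` {a..b::real})"
proof -
  have "compact ((\<lambda>y. \<bar>(deriv ^^ 3) W (poly p y)\<bar>) ` {a..b})"
    by (intro compact_continuous_image continuous_intros
        continuous_on_compose2[OF C3_derivatives(4)[OF assms]]) auto
  then show ?thesis by (intro bounded_imp_bdd_above compact_imp_bounded)
qed

text \<open>
  The Taylor expansion about the cell average uses derivatives at intermediate values.  These values
  are attained by \<open>p\<close> on the cell, so the maximum of the third derivative over the cell controls them.
\<close>

lemma cell_avg_segment:
  assumes ab: "a < b" and y: "y \<in> {a..b}"
  shows "closed_segment (cell_avg a b p) (poly p y) \<subseteq> poly p ` {a..b}"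
proof -
  have "continuous_on {a..b} (poly p)" by (intro continuous_on_poly continuous_on_id)
  then obtain l r where lr: "poly p ` {a..b} = {l..r}" "l \<le> r"
    using continuous_image_closed_interval[of a b "poly p"] ab by auto
  have int: "poly p integrable_on {a..b}"
    by (intro integrable_continuous_real continuous_on_poly continuous_on_id)
  have bd: "l \<le> poly p z" "poly p z \<le> r" if "z \<in> {a..b}" for z
    using lr(1) that by (metis atLeastAtMost_iff imageI)+
  have "integral {a..b} (\<lambda>z. l) \<le> integral {a..b} (poly p)"
    by (rule integral_le) (use int bd in auto)
  moreover have "integral {a..b} (poly p) \<le> integral {a..b} (\<lambda>z. r)"
    by (rule integral_le) (use int bd in auto)
  ultimately have "cell_avg a b p \<in> {l..r}"
    using ab by (simp add: cell_avg_def field_simps)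
  then show ?thesis
    unfolding lr(1) using bd[OF y] by (auto simp: closed_segment_eq_real_ivl split: if_splits)
qed

lemma integral_diff_cell_avg:
  assumes ab: "a < b"
  shows "integral {a..b} (\<lambda>y. poly p y - cell_avg a b p) = 0"
proof -
  have "integral {a..b} (\<lambda>y. poly p y - cell_avg a b p)
    = integral {a..b} (\<lambda>y. poly p y) - integral {a..b} (\<lambda>y. cell_avg a b p)"
    by (rule integral_diff) (auto intro!: integrable_continuous_real continuous_intros)
  then show ?thesis using ab by (simp add: cell_avg_def)
qed

text \<open>
  The linearisation of \<open>V'\<close> at the cell average, composed with \<open>p\<close>, is itself a polynomial of degree at
  most \<open>k\<close>, so it competes with the projection.  Its error is pointwise quadratic in the fluctuation
  \<open>p - cell_avg a b p\<close>; the $L^2$ norm of a square is a squared $L^4$ norm, and the inverse inequality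
  brings this back to the squared $L^2$ norm in which the damping term is measured.
\<close>

lemma entropy_variable_projection_error:
  assumes ab: "a < b" and p: "degree p \<le> k" and C: "inverse_const k C" and V: "C3 V"
    and S: "\<And>y. y \<in> {a..b} \<Longrightarrow> \<bar>(deriv ^^ 3) V (poly p y)\<bar> \<le> S"
  defines "g \<equiv> \<lambda>y. deriv V (poly p y)"
  shows "L2_norm_on a b (\<lambda>y. g y - poly (L2_proj k a b g) y)
    \<le> C / (2 * sqrt (b - a)) * S * integral {a..b} (\<lambda>y. (poly p y - cell_avg a b p)\<^sup>2)"
proof -
  define c where "c = cell_avg a b p"
  define r where "r = [:deriv V c - (deriv ^^ 2) V c * c:] + smult ((deriv ^^ 2) V c) p"
  define d where "d = p - [:c:]"
  have S0: "0 \<le> S" using S[of a] ab by force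
  have C0: "0 < C" using C by (simp add: inverse_const_def)
  have cg: "continuous_on {a..b} g"
    unfolding g_def by (intro continuous_on_compose2[OF C3_continuous(2)[OF V]] continuous_intros) auto
  have "degree r \<le> k"
    unfolding r_def using p by (intro degree_add_le) (auto intro: order_trans[OF degree_smult_le])
  then have "L2_norm_on a b (\<lambda>y. g y - poly (L2_proj k a b g) y) \<le> L2_norm_on a b (\<lambda>y. g y - poly r y)"
    by (rule L2_proj_best_approximation[OF ab cg])
  also have "\<dots> \<le> sqrt (integral {a..b} (\<lambda>y. (S / 2)\<^sup>2 * poly d y ^ 4))"
    unfolding L2_norm_on_def
  proof (intro real_sqrt_le_mono integral_le)
    fix y assume y: "y \<in> {a..b}"
    have "\<bar>g y - poly r y\<bar> = \<bar>deriv V (poly p y) - deriv V c - (deriv ^^ 2) V c * (poly p y - c)\<bar>"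
      by (simp add: g_def r_def algebra_simps)
    also have "\<dots> \<le> S / 2 * (poly p y - c)\<^sup>2"
      by (rule Taylor_quadratic_remainder[OF C3_derivatives(2,3)[OF V]])
        (use cell_avg_segment[OF ab y, of p] S in \<open>auto simp: c_def\<close>)
    finally have "\<bar>g y - poly r y\<bar>\<^sup>2 \<le> (S / 2 * (poly p y - c)\<^sup>2)\<^sup>2"
      by (intro power_mono) auto
    also have "\<dots> = (S / 2)\<^sup>2 * (poly p y - c) ^ 4"
      unfolding power_mult_distrib by (simp flip: power_mult)
    finally show "(g y - poly r y)\<^sup>2 \<le> (S / 2)\<^sup>2 * poly d y ^ 4"
      by (simp add: d_def)
  qed (auto intro!: integrable_continuous_real continuous_intros cg)
  also have "\<dots> = S / 2 * sqrt (integral {a..b} (\<lambda>y. poly d y ^ 4))"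
    using S0 by (simp add: real_sqrt_mult)
  also have "\<dots> \<le> S / 2 * (C / sqrt (b - a) * integral {a..b} (\<lambda>y. (poly d y)\<^sup>2))"
  proof (rule mult_left_mono)
    let ?X = "integral {a..b} (\<lambda>y. poly d y ^ 4)" and ?I = "integral {a..b} (\<lambda>y. (poly d y)\<^sup>2)"
    have X0: "0 \<le> ?X" by (rule integral_nonneg) (auto intro!: integrable_continuous_real continuous_intros)
    have I0: "0 \<le> ?I" by (rule integral_nonneg) (auto intro!: integrable_continuous_real continuous_intros)
    have "degree d \<le> k" unfolding d_def using p by (intro degree_diff_le) auto
    then have "root 4 ?X \<le> sqrt C * (b - a) powr (- 1 / 4) * sqrt ?I"
      using C ab by (simp add: inverse_const_def L4_norm_on_def L2_norm_on_def)
    then have "(root 4 ?X)\<^sup>2 \<le> (sqrt C * (b - a) powr (- 1 / 4) * sqrt ?I)\<^sup>2"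
      using X0 by (intro power_mono) auto
    also have "\<dots> = C * ((b - a) powr (- 1 / 4))\<^sup>2 * ?I"
      using C0 I0 by (simp add: power_mult_distrib)
    also have "((b - a) powr (- 1 / 4))\<^sup>2 = 1 / sqrt (b - a)"
      using ab by (simp add: power2_eq_square powr_half_sqrt powr_minus_divide flip: powr_add)
    also have "(root 4 ?X)\<^sup>2 = sqrt ?X"
    proof -
      have "root 4 ?X = sqrt (sqrt ?X)"
        using real_root_mult_exp[of 2 2 ?X] by (simp add: sqrt_def)
      then show ?thesis using X0 by simp
    qed
    finally show "sqrt ?X \<le> C / sqrt (b - a) * ?I" by simp
  qed (use S0 in simp)
  finally show ?thesis by (simp add: d_def c_def mult_ac)
qed

text \<open>
  The condition on \<open>\<beta>\<close> concerns \<open>V'(p)\<close> shifted by a constant; the projection reproduces constants, so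
  it bounds the gap between the traces of \<open>V'(p)\<close> and of its projection.
\<close>

lemma trace_projection_error:
  assumes ab: "a < b" and beta: "admissible_beta k \<beta>" and p: "degree p \<le> k" and V: "C3 V" and e: "e \<in> {a, b}"
  shows "\<bar>poly (L2_proj k a b (\<lambda>y. deriv V (poly p y))) e - deriv V (poly p e)\<bar>
    \<le> \<beta> / (2 * (b - a)) * (SUP y\<in>{a..b}. \<bar>(deriv ^^ 3) V (poly p y)\<bar>)
        * integral {a..b} (\<lambda>y. (poly p y - cell_avg a b p)\<^sup>2)"
proof -
  have cg: "continuous_on {a..b} (\<lambda>y. deriv V (poly p y))"
    by (intro continuous_on_compose2[OF C3_continuous(2)[OF V]] continuous_intros) auto
  show ?thesis
    using beta[unfolded admissible_beta_def, rule_format, OF ab p V e]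
    by (simp add: L2_proj_diff_const[OF ab cg])
qed

text \<open>
  The sign is needed to pass from the third derivative of \<open>V\<close> to the larger one of \<open>U\<close>.  It follows
  by testing admissibility with the exponential function and a nonconstant polynomial; that polynomial
  exists because \<open>1 \<le> k\<close>.
\<close>

lemma admissible_beta_nonneg:
  assumes "admissible_beta k \<beta>" "1 \<le> k"
  shows "0 \<le> \<beta>"
proof -
  let ?p = "[:0, 1:] :: real poly"
  have "deriv exp = (exp :: real \<Rightarrow> real)"
    by (intro ext DERIV_imp_deriv DERIV_exp)
  then have exp: "(deriv ^^ n) exp = (exp :: real \<Rightarrow> real)" for n
    by (induction n) simp_all
  have C3: "C3 exp"
    unfolding C3_def exp by (auto intro!: continuous_intros simp: real_differentiable_def intro: DERIV_exp)
  define Q where "Q = (SUP y\<in>{0..1}. \<bar>(deriv ^^ 3) exp (poly ?p y)\<bar>)"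
  define I where "I = integral {0..1} (\<lambda>y. (poly ?p y - cell_avg 0 1 ?p)\<^sup>2)"
  have "0 < \<bar>(deriv ^^ 3) exp (poly ?p 0)\<bar>" by (simp add: exp)
  also have "\<dots> \<le> Q" unfolding Q_def by (rule cSUP_upper[OF _ bdd_above_third_derivative[OF C3]]) simp
  finally have Q: "0 < Q" .
  have "0 \<le> I" unfolding I_def
    by (rule integral_nonneg) (auto intro!: integrable_continuous_real continuous_intros)
  moreover have "I \<noteq> 0"
  proof
    assume "I = 0"
    then have "\<forall>y\<in>{0..1}. (poly ?p y - cell_avg 0 1 ?p)\<^sup>2 = 0"
      unfolding I_def by (rule iffD1[OF integral_eq_0_iff, rotated 3]) (auto intro!: continuous_intros)
    from this[rule_format, of 0] this[rule_format, of 1] show False by simp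
  qed
  ultimately have I: "0 < I" by simp
  have "0 \<le> \<beta> / 2 * Q * I"
    using order_trans[OF abs_ge_zero trace_projection_error[OF _ assms(1) _ C3, of 0 1 ?p 0]] assms(2)
    by (simp add: Q_def I_def)
  then show ?thesis using Q I by (simp add: zero_le_mult_iff)
qed

section \<open>Entropy balance on a cell\<close>

text \<open>
  The fluctuation has mean zero, so a constant may be subtracted from \<open>V'\<close>; strong monotonicity of
  \<open>V'\<close> then gives the dissipation.
\<close>

lemma damping_dissipation:
  assumes ab: "a < b" and V: "C3 V" and m: "\<And>w. m \<le> (deriv ^^ 2) V w"
  shows "m * integral {a..b} (\<lambda>y. (poly p y - cell_avg a b p)\<^sup>2)
    \<le> integral {a..b} (\<lambda>y. (poly p y - cell_avg a b p) * deriv V (poly p y))"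
proof -
  define c where "c = cell_avg a b p"
  note ci = continuous_on_compose2[OF C3_continuous(2)[OF V]]
  have mono: "m * (w - c)\<^sup>2 \<le> (w - c) * (deriv V w - deriv V c)" for w
  proof -
    obtain z where "deriv V w - deriv V c = (w - c) * (deriv ^^ 2) V z"
    proof (cases w c rule: linorder_cases)
      case less
      then obtain z where "deriv V c - deriv V w = (c - w) * (deriv ^^ 2) V z"
        using MVT2[of w c "deriv V" "(deriv ^^ 2) V"] C3_derivatives(2)[OF V] by blast
      then show ?thesis by (intro that[of z]) (simp add: algebra_simps)
    next
      case greater
      then show ?thesis
        using MVT2[of c w "deriv V" "(deriv ^^ 2) V"] C3_derivatives(2)[OF V] that by blast
    qed (use that in auto)
    then show ?thesis
      using mult_right_mono[OF m[of z], of "(w - c)\<^sup>2"] by (simp add: power2_eq_square mult_ac)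
  qed
  have "m * integral {a..b} (\<lambda>y. (poly p y - c)\<^sup>2) = integral {a..b} (\<lambda>y. m * (poly p y - c)\<^sup>2)"
    by simp
  also have "\<dots> \<le> integral {a..b} (\<lambda>y. (poly p y - c) * (deriv V (poly p y) - deriv V c))"
    by (intro integral_le integrable_continuous_real) (auto intro!: continuous_intros ci mono)
  also have "\<dots> = integral {a..b} (\<lambda>y. (poly p y - c) * deriv V (poly p y) - deriv V c * (poly p y - c))"
    by (simp add: algebra_simps)
  also have "\<dots> = integral {a..b} (\<lambda>y. (poly p y - c) * deriv V (poly p y))
      - integral {a..b} (\<lambda>y. deriv V c * (poly p y - c))"
    by (rule integral_diff) (auto intro!: integrable_continuous_real continuous_intros ci)
  also have "\<dots> = integral {a..b} (\<lambda>y. (poly p y - c) * deriv V (poly p y))"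
    using integral_diff_cell_avg[OF ab, of p] by (simp add: c_def)
  finally show ?thesis by (simp add: c_def)
qed

text \<open>
  The derivative of \<open>V' * fhat um up - \<psi>\<close> is \<open>V'' * (fhat um up - f)\<close>, because the terms with \<open>V' * f'\<close>
  cancel.  By the E-flux condition and convexity it does not change sign between the two traces, and
  its sign is such that replacing the left trace by the right one in the numerical entropy flux can
  only lower the flux.
\<close>

lemma E_flux_potential_jump:
  assumes E: "E_flux f fhat" and f: "\<And>w. (f has_real_derivative deriv f w) (at w)"
    and V: "C3 V" and conv: "\<And>w. 0 \<le> (deriv ^^ 2) V w" and F: "entropy_flux f V F"
  shows "deriv V up * fhat um up - entropy_potential f V F up
    \<le> deriv V um * fhat um up - entropy_potential f V F um"
proof -
  define G where "G = (\<lambda>w. deriv V w * fhat um up - entropy_potential f V F w)"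
  have G: "(G has_real_derivative (deriv ^^ 2) V w * (fhat um up - f w)) (at w)" for w
    unfolding G_def entropy_potential_def
    by (rule derivative_eq_intros refl C3_derivatives(2)[OF V] f
        F[unfolded entropy_flux_def, rule_format])+ (simp add: algebra_simps)
  have seg: "(fhat um up - f w) * (up - um) \<le> 0" if "w \<in> closed_segment um up" for w
    using E that by (auto simp: E_flux_def)
  consider "um < up" | "up < um" | "um = up" by linarith
  then have "G up \<le> G um"
  proof cases
    case 1
    have "(deriv ^^ 2) V w * (fhat um up - f w) \<le> 0" if "um \<le> w" "w \<le> up" for w
      using seg[of w] conv[of w] 1 that
      by (intro mult_nonneg_nonpos) (auto simp: closed_segment_eq_real_ivl mult_le_0_iff)
    then show ?thesis using 1 G by (intro DERIV_nonpos_imp_nonincreasing[of um up G]) auto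
  next
    case 2
    have "0 \<le> (deriv ^^ 2) V w * (fhat um up - f w)" if "up \<le> w" "w \<le> um" for w
      using seg[of w] conv[of w] 2 that
      by (intro mult_nonneg_nonneg) (auto simp: closed_segment_eq_real_ivl mult_le_0_iff)
    then show ?thesis using 2 G by (intro DERIV_nonneg_imp_nondecreasing[of up um G]) auto
  qed simp
  then show ?thesis by (simp add: G_def)
qed

lemma poly_flux_derivative:
  assumes f: "smooth f"
  shows "((\<lambda>y. f (poly p y)) has_real_derivative deriv f (poly p y) * poly (pderiv p) y) (at y)"
    and "deriv (\<lambda>y. f (poly p y)) = (\<lambda>y. deriv f (poly p y) * poly (pderiv p) y)"
    and "continuous_on S (\<lambda>y. f (poly p y))"
    and "continuous_on S (\<lambda>y. deriv f (poly p y) * poly (pderiv p) y)"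
proof -
  have *: "((deriv ^^ n) f has_real_derivative (deriv ^^ Suc n) f w) (at w)" for n w
    using f by (simp add: smooth_def DERIV_deriv_iff_real_differentiable)
  from *[of 0] *[of 1] have f1: "(f has_real_derivative deriv f w) (at w)"
    and f2: "(deriv f has_real_derivative deriv (deriv f) w) (at w)" for w by auto
  show d: "((\<lambda>y. f (poly p y)) has_real_derivative deriv f (poly p y) * poly (pderiv p) y) (at y)" for y
    by (rule DERIV_chain2[OF f1 poly_DERIV])
  then show "deriv (\<lambda>y. f (poly p y)) = (\<lambda>y. deriv f (poly p y) * poly (pderiv p) y)"
    by (auto intro!: DERIV_imp_deriv)
  have "continuous_on UNIV f" "continuous_on UNIV (deriv f)"
    using f1 f2 by (auto intro!: DERIV_continuous_on)
  note ci = this[THEN continuous_on_compose2]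
  show "continuous_on S (\<lambda>y. f (poly p y))"
    "continuous_on S (\<lambda>y. deriv f (poly p y) * poly (pderiv p) y)"
    by (auto intro!: continuous_intros ci)
qed

text \<open>
  Integration by parts produces \<open>fx\<close> tested with the projection \<open>q\<close> of \<open>V'(p)\<close>.  Tested with \<open>V'(p)\<close>
  itself, \<open>fx\<close> would integrate to the jump of the entropy flux \<open>F\<close>.  The discrepancy is a pairing of
  two projection residuals: \<open>V'(p) - q\<close> is orthogonal to polynomials, so the projection of \<open>fx\<close> can
  be subtracted at no cost.
\<close>

lemma weak_flux_identity:
  fixes p :: "real poly" and k :: nat
  assumes ab: "a < b" and f: "smooth f" and V: "C3 V" and F: "entropy_flux f V F"
  defines "g \<equiv> \<lambda>y. deriv V (poly p y)" and "fx \<equiv> deriv (\<lambda>y. f (poly p y))"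
  defines "q \<equiv> L2_proj k a b g"
  shows "integral {a..b} (\<lambda>y. f (poly p y) * poly (pderiv q) y)
    = f (poly p b) * poly q b - f (poly p a) * poly q a - (F (poly p b) - F (poly p a))
      + integral {a..b} (\<lambda>y. (fx y - poly (L2_proj k a b fx) y) * (g y - poly q y))"
proof -
  note fd = poly_flux_derivative[OF f]
  have fx: "fx = (\<lambda>y. deriv f (poly p y) * poly (pderiv p) y)" unfolding fx_def by (rule fd(2))
  have cfx: "continuous_on {a..b} fx" unfolding fx by (rule fd(4))
  have cg: "continuous_on {a..b} g"
    unfolding g_def by (intro continuous_on_compose2[OF C3_continuous(2)[OF V]] continuous_intros) auto
  let ?P = "L2_proj k a b fx"
  have "((\<lambda>y. f (poly p y) * poly (pderiv q) y + fx y * poly q y) has_integral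
      (f (poly p b) * poly q b - f (poly p a) * poly q a)) {a..b}"
  proof (rule fundamental_theorem_of_calculus)
    fix y
    have "((\<lambda>y. f (poly p y) * poly q y) has_real_derivative
        f (poly p y) * poly (pderiv q) y + fx y * poly q y) (at y)"
      using DERIV_mult[OF fd(1) poly_DERIV] by (simp add: fx add.commute mult.commute)
    then show "((\<lambda>y. f (poly p y) * poly q y) has_vector_derivative
        f (poly p y) * poly (pderiv q) y + fx y * poly q y) (at y within {a..b})"
      unfolding has_real_derivative_iff_has_vector_derivative[symmetric]
      by (rule DERIV_subset) simp
  qed (use ab in simp)
  then have 1: "integral {a..b} (\<lambda>y. f (poly p y) * poly (pderiv q) y) + integral {a..b} (\<lambda>y. fx y * poly q y)
      = f (poly p b) * poly q b - f (poly p a) * poly q a"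
    by (subst integral_add[symmetric]) 
      (auto intro!: integrable_continuous_real continuous_intros cfx fd(3))
  have "((\<lambda>y. fx y * g y) has_integral (F (poly p b) - F (poly p a))) {a..b}"
  proof (rule fundamental_theorem_of_calculus)
    fix y
    have "((\<lambda>y. F (poly p y)) has_real_derivative
        deriv V (poly p y) * deriv f (poly p y) * poly (pderiv p) y) (at y)"
      by (rule DERIV_chain2[OF _ poly_DERIV]) (use F in \<open>simp add: entropy_flux_def\<close>)
    then show "((\<lambda>y. F (poly p y)) has_vector_derivative fx y * g y) (at y within {a..b})"
      unfolding has_real_derivative_iff_has_vector_derivative[symmetric]
      by (auto simp: fx g_def mult_ac intro: DERIV_subset)
  qed (use ab in simp)
  then have 2: "integral {a..b} (\<lambda>y. fx y * g y) = F (poly p b) - F (poly p a)"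
    by (rule integral_unique)
  have 3: "integral {a..b} (\<lambda>y. (g y - poly q y) * poly ?P y) = 0"
    unfolding q_def by (rule L2_proj_orthogonal[OF ab cg degree_L2_proj[OF ab cfx]])
  have "integral {a..b} (\<lambda>y. (fx y - poly ?P y) * (g y - poly q y))
    = integral {a..b} (\<lambda>y. fx y * g y - fx y * poly q y - (g y - poly q y) * poly ?P y)"
    by (simp add: algebra_simps)
  also have "\<dots> = integral {a..b} (\<lambda>y. fx y * g y) - integral {a..b} (\<lambda>y. fx y * poly q y)
      - integral {a..b} (\<lambda>y. (g y - poly q y) * poly ?P y)"
    by (subst integral_diff, auto intro!: integrable_continuous_real continuous_intros cfx cg)+
  finally show ?thesis using 1 2 3 by simp
qed

text \<open>
  Testing the scheme with the projected entropy variable \<open>q\<close> leaves three error terms: the volume term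
  \<open>Z\<close> and one term at each edge of the cell.  Each is at most the maximum \<open>S\<close> of the third derivative
  times \<open>I\<close>, the squared fluctuation, times one of the summands of the damping coefficient.  The damping
  term supplies at least \<open>m * I\<close> times that coefficient, where \<open>m\<close> is the infimum of \<open>U''\<close>.  The entropy
  \<open>V\<close> enters only through a lower bound on \<open>V''\<close> and an upper bound on its third derivative, and this is
  why damping designed for \<open>U\<close> serves every \<open>V\<close> with \<open>V'' \<ge> inf U''\<close> and $|V'''| \le |U'''|$.
\<close>

lemma local_entropy_inequality_of_dominated_entropy:
  assumes f: "smooth f" and mesh: "mesh N x" and k: "1 \<le> k"
    and C: "inverse_const k C" and beta: "admissible_beta k \<beta>" and E: "E_flux f fhat"
    and T: "is_interval T" "interior T \<noteq> {}"
    and sol: "scheme_B_solution k C \<beta> N x f fhat U T bl br u"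
    and U: "C3 U" and m0: "0 < (INF w. (deriv ^^ 2) U w)"
    and V: "C3 V" and V2: "\<And>w. (INF w. (deriv ^^ 2) U w) \<le> (deriv ^^ 2) V w"
    and V3: "\<And>w. \<bar>(deriv ^^ 3) V w\<bar> \<le> \<bar>(deriv ^^ 3) U w\<bar>"
    and F: "entropy_flux f V F" and t: "t \<in> T" and j: "j \<in> {1..N}"
  shows "local_entropy_inequality N x f fhat V F T bl br u t j"
proof -
  define a b p where "a = x (j - 1)" and "b = x j" and "p = u t j"
  define m where "m = (INF w. (deriv ^^ 2) U w)"
  have ab: "a < b" using mesh j by (simp add: mesh_def a_def b_def)
  have cell: "cell x j = {a..b}" by (simp add: cell_def a_def b_def)
  have solt: "u s \<in> dg_space N k" if "s \<in> T" for s
    using sol that unfolding scheme_B_solution_def by blast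
  have deg: "degree (u s j) \<le> k" if "s \<in> T" for s
    using solt[OF that] j unfolding dg_space_def by blast
  have p: "degree p \<le> k" using deg[OF t] by (simp add: p_def)
  \<comment> \<open>Derivatives within \<open>T\<close> are unique because \<open>T\<close> has no isolated points.\<close>
  have "t islimpt T"
  proof (rule connected_imp_perfect[OF _ t])
    show "connected T" using T(1) by (simp add: is_interval_connected_1)
    show "T \<noteq> {s}" for s using T(2) by auto
  qed
  then have nontriv: "at t within T \<noteq> bot" by (simp add: trivial_limit_within)
  have diff: "(\<lambda>s. poly (u s j) y) differentiable (at t within T)" if "y \<in> {a..b}" for y
    using sol t j that[folded cell] unfolding scheme_B_solution_def by blast
  obtain R where R: "degree R \<le> k"
    and ut: "\<And>y. vector_derivative (\<lambda>s. poly (u s j) y) (at t within T) = poly R y"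
    and dV: "((\<lambda>s. integral {a..b} (\<lambda>y. V (poly (u s j) y))) has_real_derivative
           integral {a..b} (\<lambda>y. deriv V (poly p y) * poly R y)) (at t within T)"
    using has_real_derivative_integral_poly[of a b t T "\<lambda>s. u s j" k V "deriv V" "(deriv ^^ 2) V",
        OF ab t nontriv deg diff C3_derivatives(1,2)[OF V] C3_continuous(3)[OF V]]
    unfolding p_def by blast
  define g fx where "g = (\<lambda>y. deriv V (poly p y))" and "fx = deriv (\<lambda>y. f (poly p y))"
  define q where "q = L2_proj k a b g"
  define D where "D = integral {a..b} (\<lambda>y. g y * poly R y)"
  define I where "I = integral {a..b} (\<lambda>y. (poly p y - cell_avg a b p)\<^sup>2)"
  define J where "J = integral {a..b} (\<lambda>y. (poly p y - cell_avg a b p) * g y)"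
  define S where "S = (SUP y\<in>{a..b}. \<bar>(deriv ^^ 3) U (poly p y)\<bar>)"
  define L where "L = L2_norm_on a b (\<lambda>y. fx y - poly (L2_proj k a b fx) y)"
  define Z where "Z = integral {a..b} (\<lambda>y. (fx y - poly (L2_proj k a b fx) y) * (g y - poly q y))"
  define fa fb where "fa = num_flux N x fhat (bl t) (br t) (u t) (j - 1)"
    and "fb = num_flux N x fhat (bl t) (br t) (u t) j"
  define B where "B = damping k C \<beta> N x f fhat U (bl t) (br t) (u t) j"
  have tb: "trace_minus x (bl t) (u t) j = poly p b"
    using j by (simp add: trace_minus_def p_def b_def)
  have ta: "trace_plus N x (br t) (u t) (j - 1) = poly p a"
  proof -
    have "j - 1 \<noteq> N" "j - 1 + 1 = j" using j by auto
    then show ?thesis by (simp only: trace_plus_def p_def a_def if_False)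
  qed
  have cg: "continuous_on {a..b} g"
    unfolding g_def by (intro continuous_on_compose2[OF C3_continuous(2)[OF V]] continuous_intros) auto
  have q: "degree q \<le> k" unfolding q_def by (rule degree_L2_proj[OF ab cg])
  have cfx: "continuous_on {a..b} fx"
    unfolding fx_def poly_flux_derivative(2)[OF f] by (rule poly_flux_derivative(4)[OF f])
  have beta0: "0 \<le> \<beta>" by (rule admissible_beta_nonneg[OF beta k])
  have C0: "0 < C" using C by (simp add: inverse_const_def)
  have m: "0 < m" using m0 by (simp add: m_def)
  have I0: "0 \<le> I" unfolding I_def
    by (rule integral_nonneg) (auto intro!: integrable_continuous_real continuous_intros)
  have L0: "0 \<le> L" unfolding L_def L2_norm_on_def
    by (intro real_sqrt_ge_zero integral_nonneg)
      (auto intro!: integrable_continuous_real continuous_intros cfx)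
  have US: "\<bar>(deriv ^^ 3) U (poly p y)\<bar> \<le> S" if "y \<in> {a..b}" for y
    unfolding S_def by (rule cSUP_upper[OF that bdd_above_third_derivative[OF U]])
  have VS: "\<bar>(deriv ^^ 3) V (poly p y)\<bar> \<le> S" if "y \<in> {a..b}" for y
    using V3[of "poly p y"] US[OF that] by linarith
  have S0: "0 \<le> S" using US[of a] ab by force
  have SV: "(SUP y\<in>{a..b}. \<bar>(deriv ^^ 3) V (poly p y)\<bar>) \<le> S"
    using VS ab by (intro cSUP_least) auto
  have trace: "\<bar>poly q e - g e\<bar> \<le> \<beta> / (2 * (b - a)) * S * I" if "e \<in> {a, b}" for e
  proof -
    have "\<bar>poly q e - g e\<bar> \<le> \<beta> / (2 * (b - a)) * (SUP y\<in>{a..b}. \<bar>(deriv ^^ 3) V (poly p y)\<bar>) * I"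
      using trace_projection_error[OF ab beta p V that] unfolding q_def g_def I_def .
    also have "\<dots> \<le> \<beta> / (2 * (b - a)) * S * I"
      using beta0 ab I0 SV by (intro mult_right_mono mult_left_mono) auto
    finally show ?thesis .
  qed
  have Z: "\<bar>Z\<bar> \<le> L * (C / (2 * sqrt (b - a)) * S * I)"
  proof -
    have "\<bar>Z\<bar> \<le> L * L2_norm_on a b (\<lambda>y. g y - poly q y)"
      unfolding Z_def L_def by (rule integral_Cauchy_Schwarz[OF ab]) (auto intro!: continuous_intros cfx cg)
    also have "\<dots> \<le> L * (C / (2 * sqrt (b - a)) * S * I)"
      using entropy_variable_projection_error[OF ab p C V VS] L0
      unfolding g_def q_def I_def by (intro mult_left_mono)
    finally show ?thesis .
  qed
  have "m * I \<le> J"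
    using damping_dissipation[OF ab V V2] unfolding m_def I_def J_def g_def .
  define \<Gamma> where "\<Gamma> = C / (2 * sqrt (b - a)) * L + \<beta> / (2 * (b - a)) *
      (\<bar>fa - f (poly p a)\<bar> + \<bar>- fb + f (poly p b)\<bar>)"
  have B: "B = S / m * \<Gamma>"
    unfolding B_def damping_def Let_def H_plus_def H_minus_def ta tb \<Gamma>_def S_def m_def L_def fx_def
      fa_def fb_def
    by (simp add: a_def b_def p_def)
  have "0 \<le> \<Gamma>" unfolding \<Gamma>_def using C0 beta0 L0 ab by (intro add_nonneg_nonneg mult_nonneg_nonneg) auto
  then have "0 \<le> B" using S0 m by (simp add: B)
  then have "B * (m * I) \<le> B * J" using \<open>m * I \<le> J\<close> by (rule mult_left_mono[rotated])
  then have BJ: "S * \<Gamma> * I \<le> B * J" using m by (simp add: B)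
  \<comment> \<open>Both the time derivative and the fluctuation are polynomials of degree at most \<open>k\<close>, so in their
    pairings \<open>V'(p)\<close> may be replaced by the admissible test function \<open>q\<close>.\<close>
  have Dq: "D = integral {a..b} (\<lambda>y. poly R y * poly q y)"
    unfolding D_def q_def by (subst integral_mult_L2_proj[OF ab cg R]) (simp add: mult.commute)
  have Jq: "J = integral {a..b} (\<lambda>y. (poly p y - cell_avg a b p) * poly q y)"
    unfolding J_def q_def
    using integral_mult_L2_proj[OF ab cg, of "p - [:cell_avg a b p:]" k] p
    by (simp add: mult.commute degree_diff_le)
  have "(\<lambda>_. q) \<in> dg_space N k" using q by (simp add: dg_space_def)
  from sol[unfolded scheme_B_solution_def, rule_format, OF t, THEN conjunct2, rule_format, OF j,
      THEN conjunct2, rule_format, OF this]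
  have scheme: "D - integral {a..b} (\<lambda>y. f (poly p y) * poly (pderiv q) y)
      + fb * poly q b - fa * poly q a = - B * J"
    unfolding ut cell Dq Jq fa_def fb_def B_def by (simp add: a_def b_def p_def)
  have flux: "integral {a..b} (\<lambda>y. f (poly p y) * poly (pderiv q) y)
      = f (poly p b) * poly q b - f (poly p a) * poly q a - (F (poly p b) - F (poly p a)) + Z"
    unfolding Z_def q_def g_def fx_def by (rule weak_flux_identity[OF ab f V F])
  have right: "num_entropy_flux N x f fhat V F (bl t) (br t) (u t) j
      = g b * fb - (g b * f (poly p b) - F (poly p b))"
    by (simp add: num_entropy_flux_def tb fb_def entropy_potential_def g_def)
  have left: "g a * fa - (g a * f (poly p a) - F (poly p a))
     \<le> num_entropy_flux N x f fhat V F (bl t) (br t) (u t) (j - 1)"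
  proof -
    have "(f has_real_derivative deriv f w) (at w)" for w
      using f[unfolded smooth_def, rule_format, of 0 w]
      by (simp add: DERIV_deriv_iff_real_differentiable)
    moreover have "0 \<le> (deriv ^^ 2) V w" for w using V2[of w] m0 by linarith
    ultimately have "deriv V up * fhat um up - entropy_potential f V F up
        \<le> deriv V um * fhat um up - entropy_potential f V F um" for um up
      by (intro E_flux_potential_jump[OF E _ V _ F])
    from this[of "trace_plus N x (br t) (u t) (j - 1)" "trace_minus x (bl t) (u t) (j - 1)"]
    show ?thesis
      unfolding num_entropy_flux_def fa_def num_flux_def ta
      by (simp add: entropy_potential_def g_def)
  qed
  have pairing: "X * Y \<le> \<bar>X\<bar> * K" if "\<bar>Y\<bar> \<le> K" for X Y K :: real
    using order_trans[OF abs_ge_self[of "X * Y"]] mult_left_mono[OF that, of "\<bar>X\<bar>"]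
    by (simp add: abs_mult)
  have Hb: "(- fb + f (poly p b)) * (poly q b - g b) \<le> \<bar>- fb + f (poly p b)\<bar> * (\<beta> / (2 * (b - a)) * S * I)"
    by (rule pairing[OF trace]) simp
  have Ha: "(fa - f (poly p a)) * (poly q a - g a) \<le> \<bar>fa - f (poly p a)\<bar> * (\<beta> / (2 * (b - a)) * S * I)"
    by (rule pairing[OF trace]) simp
  have Rb: "(- fb + f (poly p b)) * (poly q b - g b)
      = f (poly p b) * poly q b - fb * poly q b + g b * fb - g b * f (poly p b)"
    by (simp add: left_diff_distrib right_diff_distrib mult.commute)
  have Ra: "(fa - f (poly p a)) * (poly q a - g a)
      = fa * poly q a - f (poly p a) * poly q a - g a * fa + g a * f (poly p a)"
    by (simp add: left_diff_distrib right_diff_distrib mult.commute)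
  have "D + num_entropy_flux N x f fhat V F (bl t) (br t) (u t) j
      - num_entropy_flux N x f fhat V F (bl t) (br t) (u t) (j - 1)
    \<le> Z + (- fb + f (poly p b)) * (poly q b - g b) + (fa - f (poly p a)) * (poly q a - g a) - B * J"
    using scheme left flux right Ra Rb by linarith
  also have "\<dots> \<le> S * \<Gamma> * I - B * J"
  proof -
    have "S * \<Gamma> * I = L * (C / (2 * sqrt (b - a)) * S * I)
        + \<bar>- fb + f (poly p b)\<bar> * (\<beta> / (2 * (b - a)) * S * I)
        + \<bar>fa - f (poly p a)\<bar> * (\<beta> / (2 * (b - a)) * S * I)"
      unfolding \<Gamma>_def by (simp add: distrib_left distrib_right mult_ac)
    then show ?thesis using Z Ha Hb by linarith
  qed
  also have "\<dots> \<le> 0" using BJ by simp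
  finally show ?thesis
    unfolding local_entropy_inequality_def cell using dV unfolding D_def g_def by blast
qed

section \<open>Entropies given by even power series\<close>

definition even_coeffs :: "(nat \<Rightarrow> real) \<Rightarrow> nat \<Rightarrow> real" where
  "even_coeffs b n = (if even n \<and> 0 < n then b (n div 2) else 0)"

lemma even_series_reindex:
  assumes "\<And>w. summable (\<lambda>i. b (Suc i) * w ^ (2 * Suc i))"
  shows "summable (\<lambda>n. even_coeffs b n * w ^ n)"
    and "even_series b w = (\<Sum>n. even_coeffs b n * w ^ n)"
proof -
  have mono: "strict_mono (\<lambda>i::nat. 2 * Suc i)" by (auto simp: strict_mono_def)
  have zero: "even_coeffs b n * w ^ n = 0" if "n \<notin> range (\<lambda>i::nat. 2 * Suc i)" for n
  proof -
    have "\<not> (even n \<and> 0 < n)"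
    proof
      assume "even n \<and> 0 < n"
      then obtain i where "n = 2 * i" "0 < i" by auto
      then have "n = 2 * Suc (i - 1)" by simp
      then show False using that by blast
    qed
    then show ?thesis by (auto simp: even_coeffs_def)
  qed
  have eq: "(\<lambda>i. b (Suc i) * w ^ (2 * Suc i)) = (\<lambda>i. even_coeffs b (2 * Suc i) * w ^ (2 * Suc i))"
    by (simp add: even_coeffs_def)
  show "summable (\<lambda>n. even_coeffs b n * w ^ n)"
    using summable_mono_reindex[where f = "\<lambda>n. even_coeffs b n * w ^ n", OF mono zero] assms[of w] unfolding eq by blast
  have "(\<lambda>i. b (Suc i) * w ^ (2 * Suc i)) sums even_series b w"
    using summable_sums[OF assms] by (simp add: even_series_def)
  then have "(\<lambda>n. even_coeffs b n * w ^ n) sums even_series b w"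
    unfolding eq using sums_mono_reindex[where f = "\<lambda>n. even_coeffs b n * w ^ n", OF mono zero] by blast
  then show "even_series b w = (\<Sum>n. even_coeffs b n * w ^ n)" by (rule sums_unique)
qed

lemma funpow_deriv_power_series:
  fixes c :: "nat \<Rightarrow> real"
  assumes "\<And>w. summable (\<lambda>n. c n * w ^ n)"
  shows "summable (\<lambda>n. (diffs ^^ m) c n * w ^ n)"
    and "(deriv ^^ m) (\<lambda>w. \<Sum>n. c n * w ^ n) = (\<lambda>w. \<Sum>n. (diffs ^^ m) c n * w ^ n)"
    and "((deriv ^^ m) (\<lambda>w. \<Sum>n. c n * w ^ n) has_real_derivative
          (\<Sum>n. (diffs ^^ Suc m) c n * w ^ n)) (at w)"
proof -
  have sum: "summable (\<lambda>n. (diffs ^^ m) c n * w ^ n)" for m w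
  proof (induction m arbitrary: w)
    case (Suc m)
    then show ?case using termdiff_converges_all[of "(diffs ^^ m) c" w] by simp
  qed (simp add: assms)
  have d: "((\<lambda>w. \<Sum>n. (diffs ^^ m) c n * w ^ n) has_real_derivative
      (\<Sum>n. (diffs ^^ Suc m) c n * w ^ n)) (at w)" for m w
    using termdiffs_strong_converges_everywhere[of "(diffs ^^ m) c" w] sum by simp
  have eq: "(deriv ^^ m) (\<lambda>w. \<Sum>n. c n * w ^ n) = (\<lambda>w. \<Sum>n. (diffs ^^ m) c n * w ^ n)" for m
  proof (induction m)
    case (Suc m)
    then show ?case using d[of m] by (auto intro!: DERIV_imp_deriv)
  qed simp
  show "summable (\<lambda>n. (diffs ^^ m) c n * w ^ n)" by (rule sum)
  show "(deriv ^^ m) (\<lambda>w. \<Sum>n. c n * w ^ n) = (\<lambda>w. \<Sum>n. (diffs ^^ m) c n * w ^ n)" by (rule eq)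
  show "((deriv ^^ m) (\<lambda>w. \<Sum>n. c n * w ^ n) has_real_derivative
          (\<Sum>n. (diffs ^^ Suc m) c n * w ^ n)) (at w)"
    unfolding eq by (rule d)
qed

lemma C3_power_series:
  fixes c :: "nat \<Rightarrow> real"
  assumes "\<And>w. summable (\<lambda>n. c n * w ^ n)"
  shows "C3 (\<lambda>w. \<Sum>n. c n * w ^ n)"
  using funpow_deriv_power_series(3)[OF assms] unfolding C3_def
  by (auto simp: real_differentiable_def intro!: DERIV_continuous_on) 

lemma funpow_diffs_even_coeffs:
  shows "(diffs ^^ 2) (even_coeffs b) n = (real n + 1) * (real n + 2) * even_coeffs b (n + 2)"
    and "(diffs ^^ 3) (even_coeffs b) n = (real n + 1) * (real n + 2) * (real n + 3) * even_coeffs b (n + 3)"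
  by (simp_all add: diffs_def numeral_2_eq_2 numeral_3_eq_3 algebra_simps)

lemma C3_even_series:
  assumes "\<And>w. summable (\<lambda>i. b (Suc i) * w ^ (2 * Suc i))"
  shows "C3 (even_series b)"
proof -
  have "even_series b = (\<lambda>w. \<Sum>n. even_coeffs b n * w ^ n)"
    using even_series_reindex(2)[OF assms] by auto
  then show ?thesis using C3_power_series[OF even_series_reindex(1)[OF assms]] by simp
qed

lemma funpow_deriv_even_series:
  assumes "\<And>w. summable (\<lambda>i. b (Suc i) * w ^ (2 * Suc i))"
  shows "summable (\<lambda>n. (diffs ^^ m) (even_coeffs b) n * w ^ n)"
    and "(deriv ^^ m) (even_series b) w = (\<Sum>n. (diffs ^^ m) (even_coeffs b) n * w ^ n)"
proof -
  have *: "even_series b = (\<lambda>w. \<Sum>n. even_coeffs b n * w ^ n)"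
    using even_series_reindex(2)[OF assms] by auto
  show "summable (\<lambda>n. (diffs ^^ m) (even_coeffs b) n * w ^ n)"
    by (rule funpow_deriv_power_series(1)[OF even_series_reindex(1)[OF assms]])
  show "(deriv ^^ m) (even_series b) w = (\<Sum>n. (diffs ^^ m) (even_coeffs b) n * w ^ n)"
    unfolding * funpow_deriv_power_series(2)[OF even_series_reindex(1)[OF assms]] ..
qed

text \<open>
  Differentiating twice leaves a series in even powers with nonnegative coefficients, whose constant
  term is therefore its minimum.
\<close>

lemma second_deriv_even_series:
  assumes sum: "\<And>w. summable (\<lambda>i. b (Suc i) * w ^ (2 * Suc i))"
    and nonneg: "\<And>i. 1 \<le> i \<Longrightarrow> 0 \<le> b i"
  shows "2 * b 1 \<le> (deriv ^^ 2) (even_series b) w"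
    and "(deriv ^^ 2) (even_series b) 0 = 2 * b 1"
proof -
  let ?d = "(diffs ^^ 2) (even_coeffs b)"
  have d0: "?d 0 = 2 * b 1" unfolding funpow_diffs_even_coeffs by (simp add: even_coeffs_def)
  have "0 \<le> ?d n * w ^ n" for n
  proof (cases "even n")
    case True
    have "0 \<le> even_coeffs b (n + 2)" by (simp add: even_coeffs_def nonneg)
    then show ?thesis
      unfolding funpow_diffs_even_coeffs using True by (intro mult_nonneg_nonneg) (auto simp: zero_le_even_power)
  qed (simp add: funpow_diffs_even_coeffs even_coeffs_def)
  then have "sum (\<lambda>n. ?d n * w ^ n) {0} \<le> (\<Sum>n. ?d n * w ^ n)"
    using funpow_deriv_even_series(1)[OF sum] by (intro sum_le_suminf) auto
  then show "2 * b 1 \<le> (deriv ^^ 2) (even_series b) w"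
    by (simp add: funpow_deriv_even_series(2)[OF sum] d0)
  show "(deriv ^^ 2) (even_series b) 0 = 2 * b 1"
    using funpow_deriv_even_series(2)[OF sum, of 2 0] powser_zero[of ?d] d0 by simp
qed

text \<open>
  The third derivative kills the quadratic term, which explains why \<open>b 1\<close> may exceed \<open>a 1\<close>.  What
  remains are odd powers with coefficients ordered like those of \<open>b\<close> and \<open>a\<close>; since all of them
  have the same sign at a given \<open>w\<close>, the triangle inequality for the larger series is an equality.
\<close>

lemma third_deriv_even_series_mono:
  assumes suma: "\<And>w. summable (\<lambda>i. a (Suc i) * w ^ (2 * Suc i))"
    and sumb: "\<And>w. summable (\<lambda>i. b (Suc i) * w ^ (2 * Suc i))"
    and ba: "\<And>i. 1 < i \<Longrightarrow> 0 \<le> b i \<and> b i \<le> a i"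
  shows "\<bar>(deriv ^^ 3) (even_series b) w\<bar> \<le> \<bar>(deriv ^^ 3) (even_series a) w\<bar>"
proof -
  let ?d = "\<lambda>b. (diffs ^^ 3) (even_coeffs b)"
  have odd: "?d c n = 0" if "even n" for n c
    unfolding funpow_diffs_even_coeffs using that by (simp add: even_coeffs_def)
  have coeff: "0 \<le> ?d b n \<and> ?d b n \<le> ?d a n" for n
  proof (cases "even n")
    case False
    then have "1 < (n + 3) div 2" by presburger
    then have "0 \<le> even_coeffs b (n + 3) \<and> even_coeffs b (n + 3) \<le> even_coeffs a (n + 3)"
      using ba[of "(n + 3) div 2"] by (auto simp: even_coeffs_def)
    then show ?thesis
      unfolding funpow_diffs_even_coeffs by (intro conjI mult_nonneg_nonneg mult_left_mono) auto
  qed (simp add: odd)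
  note sums = funpow_deriv_even_series(1)[where m = 3]
  have "\<bar>(deriv ^^ 3) (even_series b) w\<bar> = \<bar>\<Sum>n. ?d b n * w ^ n\<bar>"
    by (simp add: funpow_deriv_even_series(2)[OF sumb])
  also have "\<dots> \<le> (\<Sum>n. \<bar>?d b n * w ^ n\<bar>)"
  proof (rule summable_rabs)
    show "summable (\<lambda>n. \<bar>?d b n * w ^ n\<bar>)"
      using sums[OF sumb, of "\<bar>w\<bar>"] coeff by (simp add: abs_mult power_abs)
  qed
  also have "\<dots> = (\<Sum>n. ?d b n * \<bar>w\<bar> ^ n)"
    using coeff by (simp add: abs_mult power_abs)
  also have "\<dots> \<le> (\<Sum>n. ?d a n * \<bar>w\<bar> ^ n)"
    using coeff by (intro suminf_le sums[OF suma] sums[OF sumb] mult_right_mono) auto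
  also have "\<dots> \<le> \<bar>\<Sum>n. ?d a n * w ^ n\<bar>"
  proof (cases "0 \<le> w")
    case False
    then have "?d a n * \<bar>w\<bar> ^ n = - (?d a n * w ^ n)" for n
      using odd[of n a] by (cases "even n") auto
    then have "(\<Sum>n. ?d a n * \<bar>w\<bar> ^ n) = - (\<Sum>n. ?d a n * w ^ n)"
      using suminf_minus[OF sums[OF suma, of w]] by simp
    then show ?thesis by simp
  qed simp
  also have "\<dots> = \<bar>(deriv ^^ 3) (even_series a) w\<bar>"
    by (simp add: funpow_deriv_even_series(2)[OF suma])
  finally show ?thesis .
qed

lemma even_series_summable_of_dominated:
  assumes suma: "\<And>w. summable (\<lambda>i. a (Suc i) * w ^ (2 * Suc i))"
    and ba: "\<And>i. 1 < i \<Longrightarrow> 0 \<le> b i \<and> b i \<le> a i"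
  shows "summable (\<lambda>i. b (Suc i) * (w::real) ^ (2 * Suc i))"
proof (rule summable_comparison_test'[OF suma[of w], of 1])
  fix i :: nat assume "1 \<le> i"
  then show "norm (b (Suc i) * w ^ (2 * Suc i)) \<le> a (Suc i) * w ^ (2 * Suc i)"
    using ba[of "Suc i"] by (simp add: abs_mult zero_le_even_power mult_right_mono del: power_Suc)
qed

lemma even_series_two_terms:
  assumes "1 < m"
  shows "even_series (\<lambda>i. if i = 1 then \<alpha> else if i = m then \<gamma> else 0) w = \<alpha> * w\<^sup>2 + \<gamma> * w ^ (2 * m)"
proof -
  have "even_series (\<lambda>i. if i = 1 then \<alpha> else if i = m then \<gamma> else 0) w
    = (\<Sum>i\<in>{0, m - 1}. (if Suc i = 1 then \<alpha> else if Suc i = m then \<gamma> else 0) * w ^ (2 * Suc i))"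
    unfolding even_series_def by (rule suminf_finite) auto
  also have "\<dots> = \<alpha> * w\<^sup>2 + \<gamma> * w ^ (2 * m)" using assms by (cases m) (auto simp: power2_eq_square)
  finally show ?thesis .
qed

text \<open>
  The segment from $a_1 w^2$ to $a_1 w^2 + a_m w^{2m}$ lies in the family.  All its members share the
  quadratic coefficient \<open>a 1 > 0\<close>, so no two of them are proportional; evaluation at \<open>w = 1\<close> and
  \<open>w = 2\<close> separates the two monomials.
\<close>

lemma infinitely_many_entropies_in_family:
  assumes a1: "0 < a 1" and a: "\<And>i. 1 < i \<Longrightarrow> 0 \<le> a i" and m: "1 < m" "a m \<noteq> 0"
  shows "\<exists>S\<subseteq>entropy_family a. infinite S \<and>
    (\<forall>V\<in>S. \<forall>W\<in>S. \<forall>c. V = (\<lambda>w. c * W w) \<longrightarrow> V = W)"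
proof -
  define V where "V = (\<lambda>\<theta> w. a 1 * w\<^sup>2 + \<theta> * a m * w ^ (2 * m))"
  have proportional: "c = 1 \<and> \<theta> = \<eta>" if "V \<theta> = (\<lambda>w. c * V \<eta> w)" for c \<theta> \<eta>
  proof -
    have 1: "a 1 + \<theta> * a m = c * (a 1 + \<eta> * a m)"
      using fun_cong[OF that, of 1] by (simp add: V_def)
    have "4 * a 1 + \<theta> * a m * 4 ^ m = c * (4 * a 1 + \<eta> * a m * 4 ^ m)"
      using fun_cong[OF that, of 2] unfolding V_def power_mult by (simp add: mult.commute)
    then have "(\<theta> - c * \<eta>) * a m * (4 ^ m - 4) = 0"
      using 1 by (simp add: algebra_simps)
    moreover have "(4::real) ^ 1 < 4 ^ m" using m(1) by (intro power_strict_increasing) auto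
    ultimately have eq: "\<theta> = c * \<eta>" using m(2) by simp
    with 1 have "a 1 = c * a 1" by (simp add: algebra_simps)
    then show ?thesis using eq a1 by simp
  qed
  have "V ` {0..1} \<subseteq> entropy_family a"
  proof (rule image_subsetI)
    fix \<theta> :: real assume \<theta>: "\<theta> \<in> {0..1}"
    let ?b = "\<lambda>i. if i = 1 then a 1 else if i = m then \<theta> * a m else 0"
    have "\<theta> * a m \<le> 1 * a m" using \<theta> a[OF m(1)] by (intro mult_right_mono) auto
    then have "a 1 \<le> ?b 1 \<and> (\<forall>i>1. 0 \<le> ?b i \<and> ?b i \<le> a i)"
      using \<theta> a m by auto
    moreover have "V \<theta> = even_series ?b"
      using even_series_two_terms[OF m(1)] by (auto simp: V_def)
    ultimately show "V \<theta> \<in> entropy_family a" unfolding entropy_family_def by blast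
  qed
  moreover have "infinite (V ` {0..1})"
  proof -
    have "inj V" using proportional[where c = 1] by (auto intro!: injI)
    then show ?thesis
      using finite_image_iff[OF inj_on_subset[OF _ subset_UNIV], of V "{0..1}"] by simp
  qed
  moreover have "\<forall>X\<in>V ` {0..1}. \<forall>Y\<in>V ` {0..1}. \<forall>c. X = (\<lambda>w. c * Y w) \<longrightarrow> X = Y"
  proof (intro ballI allI impI)
    fix X Y c assume "X \<in> V ` {0..1}" "Y \<in> V ` {0..1}" and XY: "X = (\<lambda>w. c * Y w)"
    then obtain \<theta> \<eta> where "X = V \<theta>" "Y = V \<eta>" by auto
    then show "X = Y" using proportional[of \<theta> c \<eta>] XY by simp
  qed
  ultimately show ?thesis by blast
qed

section \<open>Infinitely many entropy inequalities\<close>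

theorem corollary3p13:
  fixes f U :: "real \<Rightarrow> real" and fhat :: "real \<Rightarrow> real \<Rightarrow> real"
    and N k :: nat and x :: "nat \<Rightarrow> real" and C \<beta> :: real
    and a :: "nat \<Rightarrow> real"
    and T :: "real set" and bl br :: "real \<Rightarrow> real" and u :: "real \<Rightarrow> dg_fun"
  assumes "smooth f"
    and "mesh N x"
    and "k \<ge> 1"
    and "optimal_inverse_const k C"
    and "admissible_beta k \<beta>"
    and "E_flux f fhat"
    and "\<And>w. summable (\<lambda>i. a (Suc i) * w ^ (2 * Suc i))"
    and "U = even_series a"
    and "a 1 > 0"
    and "\<And>i. i > 1 \<Longrightarrow> a i \<ge> 0"
    and "\<exists>i>1. a i \<noteq> 0"
    and "is_interval T" and "interior T \<noteq> {}"
    and "scheme_B_solution k C \<beta> N x f fhat U T bl br u"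
  shows "(\<forall>V\<in>entropy_family a. \<forall>F. entropy_flux f V F \<longrightarrow>
            (\<forall>t\<in>T. \<forall>j\<in>{1..N}. local_entropy_inequality N x f fhat V F T bl br u t j)) \<and>
         (\<exists>S\<subseteq>entropy_family a. infinite S \<and>
            (\<forall>V\<in>S. \<forall>W\<in>S. \<forall>c. V = (\<lambda>w. c * W w) \<longrightarrow> V = W))"
proof (intro conjI ballI allI impI)
  note suma = assms(7)
  have a_nonneg: "0 \<le> a i" if "1 \<le> i" for i
    using that assms(9,10) by (cases "i = 1") (auto simp: less_imp_le)
  \<comment> \<open>The infimum is attained at 0.\<close>
  have inf: "(INF w. (deriv ^^ 2) U w) = 2 * a 1"
  proof (rule antisym)
    have "bdd_below (range ((deriv ^^ 2) U))"
      unfolding assms(8) by (rule bdd_belowI2[where m = "2 * a 1"])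
        (rule second_deriv_even_series(1)[OF suma a_nonneg])
    then show "(INF w. (deriv ^^ 2) U w) \<le> 2 * a 1"
      using cINF_lower[of "(deriv ^^ 2) U" UNIV 0] second_deriv_even_series(2)[OF suma a_nonneg]
      unfolding assms(8) by simp
    show "2 * a 1 \<le> (INF w. (deriv ^^ 2) U w)"
      unfolding assms(8) by (rule cINF_greatest[OF UNIV_not_empty second_deriv_even_series(1)[OF suma a_nonneg]])
  qed
  fix V F t j
  assume "V \<in> entropy_family a" and F: "entropy_flux f V F" and t: "t \<in> T" and j: "j \<in> {1..N}"
  then obtain b where V: "V = even_series b" and b1: "a 1 \<le> b 1"
    and ba: "\<And>i. 1 < i \<Longrightarrow> 0 \<le> b i \<and> b i \<le> a i"
    unfolding entropy_family_def by blast
  have sumb: "summable (\<lambda>i. b (Suc i) * w ^ (2 * Suc i))" for w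
    by (rule even_series_summable_of_dominated[OF suma ba])
  have b_nonneg: "0 \<le> b i" if "1 \<le> i" for i
    using that ba[of i] b1 assms(9) by (cases "i = 1") auto
  show "local_entropy_inequality N x f fhat V F T bl br u t j"
  proof (rule local_entropy_inequality_of_dominated_entropy[OF assms(1-3) _ assms(5,6,12,13,14) _ _ _ _ _ F t j])
    show "inverse_const k C" using assms(4) by (simp add: optimal_inverse_const_def)
    show "C3 U" unfolding assms(8) by (rule C3_even_series[OF suma])
    show "C3 V" unfolding V by (rule C3_even_series[OF sumb])
    show "0 < (INF w. (deriv ^^ 2) U w)" using assms(9) by (simp add: inf)
    show "(INF w. (deriv ^^ 2) U w) \<le> (deriv ^^ 2) V w" for w
      using second_deriv_even_series(1)[OF sumb b_nonneg, of w] b1 by (simp add: inf V)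
    show "\<bar>(deriv ^^ 3) V w\<bar> \<le> \<bar>(deriv ^^ 3) U w\<bar>" for w
      unfolding V assms(8) by (rule third_deriv_even_series_mono[OF suma sumb ba])
  qed
next
  show "\<exists>S\<subseteq>entropy_family a. infinite S \<and>
      (\<forall>V\<in>S. \<forall>W\<in>S. \<forall>c. V = (\<lambda>w. c * W w) \<longrightarrow> V = W)"
    using infinitely_many_entropies_in_family[of a, OF assms(9,10)] assms(11) by blast
qed

end
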